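(* Let $D$ be an integral domain such that $\mathfrak{I}_n(D)$ is $t$-invertible for all nonnegative integers $n$. Then, for every nonnegative integer $n$ and any $f\in\operatorname{Int}_n(D)$, all of the coefficients of $f$ lie in $\mathfrak{I}_n(D)$; one has $n!_D=(D[X]:_D\operatorname{Int}_n(D))$ and $\mathfrak{I}_n(D)=(n!_D)^{-1}$ for all $n$; the Pólya–Ostrowski group $\operatorname{POG}(D)$ is generated by (the classes of) the factorial ideals $n!_D$ for all $n$; and the following conditions are equivalent. (1) $\operatorname{Int}(D)$ has a regular basis. (2) $\mathfrak{I}_n(D)$ is principal for every nonnegative integer $n$. (3) $n!_D$ is principal for every nonnegative integer $n$. (4) $\operatorname{POG}(D)$ is trivial. Moreover, if $D$ is polynomially L-regular, then $\operatorname{Int}(D_\mathfrak{p})$ has a regular basis for every prime ideal $\mathfrak{p}$ of $D$ and the $D$-module $\operatorname{Int}(D)$ is locally free.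
   Context: Let $D$ be an integral domain with quotient field $K$. $\operatorname{Int}(D)=\{f\in K[X]: f(D)\subseteq D\}$ and $\operatorname{Int}_n(D)=\{f\in\operatorname{Int}(D):\deg f\le n\}$. The $n$th characteristic ideal $\mathfrak{I}_n(D)\subseteq K$ is the set of coefficients of $X^n$ of the polynomials in $\operatorname{Int}_n(D)$; it is a (nonzero) fractional ideal of $D$. The $n$th factorial ideal is $n!_D=\mathfrak{I}_n(D)^{-1}$. A regular basis of $\operatorname{Int}(D)$ is a $D$-module basis consisting of exactly one polynomial of each degree. $(D[X]:_D\operatorname{Int}_n(D))=\{r\in D: r\operatorname{Int}_n(D)\subseteq D[X]\}$. A fractional ideal of $D$ is a $D$-submodule $I$ of $K$ with $aI\subseteq D$ for some nonzero $a\in D$. For nonzero fractional ideals $I$: $I^{-1}=\{x\in K: xI\subseteq D\}$; $I_v=(I^{-1})^{-1}$; $I_t=\bigcup J_v$ over the nonzero finitely generated $J\subseteq I$. $I$ is a $t$-ideal if $I_t=I$, and $t$-invertible if $(II^{-1})_t=D$. The $t$-class group $\operatorname{Cl}_t(D)$ is the group of $t$-invertible $t$-ideals under the operation $(I,J)\mapsto (IJ)_t$ modulo the subgroup of nonzero principal fractional ideals. When all $\mathfrak{I}_n(D)$ are $t$-invertible (they are then $t$-ideals), the Pólya–Ostrowski group $\operatorname{POG}(D)$ is the subgroup of $\operatorname{Cl}_t(D)$ generated by the classes of the $\mathfrak{I}_n(D)$ for all $n$. $D$ is polynomially L-regular if $S^{-1}\operatorname{Int}(D)=\operatorname{Int}(S^{-1}D)$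 for every multiplicative subset $S$ of $D$ (with $0\notin S$). A $D$-module $M$ is locally free if $M_\mathfrak{p}$ is a free $D_\mathfrak{p}$-module for every prime ideal $\mathfrak{p}$ of $D$. *)

theory Defs
  imports
    "HOL-Algebra.Ideal"
    "HOL-Algebra.Module"
    "HOL-Algebra.Generated_Groups"
    "HOL-Computational_Algebra.Polynomial"
begin

text \<open>
  An integral domain \<open>D\<close> with quotient field \<open>K\<close> is given as a subset of a field type \<open>K\<close>.
  All localisations \<open>S\<^sup>-\<^sup>1 D\<close> then live in the same field, and \<open>K[X]\<close> is the library's type of
  polynomials over \<open>K\<close>.
\<close>

definition ring_on :: "'a::field set \<Rightarrow> 'a ring" where
  "ring_on D = \<lparr>carrier = D, monoid.mult = (*), one = 1, ring.zero = 0, ring.add = (+)\<rparr>"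

definition field_module :: "('a::field, 'a) module" where
  "field_module = \<lparr>carrier = UNIV, monoid.mult = (*), one = 1, ring.zero = 0, ring.add = (+),
     module.smult = (*)\<rparr>"

definition domain_with_quotient_field :: "'a::field set \<Rightarrow> bool" where
  "domain_with_quotient_field D \<longleftrightarrow>
     domain (ring_on D) \<and> (\<forall>x. \<exists>a\<in>D. \<exists>b\<in>D - {0}. x = a / b)"

subsection \<open>Modules over \<open>D\<close> inside \<open>K\<close> and \<open>K[X]\<close>\<close>

text \<open>
  Modules over a subring \<open>R\<close> of \<open>K\<close> are subsets of a \<open>K\<close>-vector space; the parameter \<open>scale\<close> is
  its scalar multiplication, \<open>(*)\<close> on \<open>K\<close> and \<open>Polynomial.smult\<close> on \<open>K[X]\<close>.
\<close>

definition span_over :: "'a set \<Rightarrow> ('a \<Rightarrow> 'b \<Rightarrow> 'b) \<Rightarrow> 'b set \<Rightarrow> 'b::ab_group_add set" where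
  "span_over R scale B =
     {\<Sum>b\<in>F. scale (c b) b | F c. finite F \<and> F \<subseteq> B \<and> c ` F \<subseteq> R}"

definition independent_over ::
    "'a::zero set \<Rightarrow> ('a \<Rightarrow> 'b \<Rightarrow> 'b) \<Rightarrow> 'b::ab_group_add set \<Rightarrow> bool" where
  "independent_over R scale B \<longleftrightarrow>
     (\<forall>F c. finite F \<and> F \<subseteq> B \<and> c ` F \<subseteq> R \<and> (\<Sum>b\<in>F. scale (c b) b) = 0 \<longrightarrow> (\<forall>b\<in>F. c b = 0))"

definition module_basis ::
    "'a::zero set \<Rightarrow> ('a \<Rightarrow> 'b \<Rightarrow> 'b) \<Rightarrow> 'b::ab_group_add set \<Rightarrow> 'b set \<Rightarrow> bool" where
  "module_basis R scale M B \<longleftrightarrow> independent_over R scale B \<and> span_over R scale B = M"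

definition free_module ::
    "'a::zero set \<Rightarrow> ('a \<Rightarrow> 'b \<Rightarrow> 'b) \<Rightarrow> 'b::ab_group_add set \<Rightarrow> bool" where
  "free_module R scale M \<longleftrightarrow> (\<exists>B. module_basis R scale M B)"

text \<open>
  Since the modules considered are torsion-free, \<open>S\<^sup>-\<^sup>1 M\<close> is the set of all \<open>s\<^sup>-\<^sup>1 m\<close> in the
  ambient vector space.
\<close>

definition localization :: "'a::field set \<Rightarrow> ('a \<Rightarrow> 'b \<Rightarrow> 'b) \<Rightarrow> 'b set \<Rightarrow> 'b set" where
  "localization S scale M = {scale (inverse s) m | s m. s \<in> S \<and> m \<in> M}"

definition multiplicative_subset :: "'a::field set \<Rightarrow> 'a set \<Rightarrow> bool" where
  "multiplicative_subset D S \<longleftrightarrow> submonoid S (ring_on D) \<and> 0 \<notin> S"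

definition locally_free ::
    "'a::field set \<Rightarrow> ('a \<Rightarrow> 'b \<Rightarrow> 'b) \<Rightarrow> 'b::ab_group_add set \<Rightarrow> bool" where
  "locally_free D scale M \<longleftrightarrow>
     (\<forall>P. primeideal P (ring_on D) \<longrightarrow>
        free_module (localization (D - P) (*) D) scale (localization (D - P) scale M))"

subsection \<open>Fractional ideals and the \<open>t\<close>-operation\<close>

definition fractional_ideal :: "'a::field set \<Rightarrow> 'a set \<Rightarrow> bool" where
  "fractional_ideal D I \<longleftrightarrow>
     submodule I (ring_on D) field_module \<and> (\<exists>a\<in>D - {0}. \<forall>x\<in>I. a * x \<in> D)"

definition principal_fractional :: "'a::field set \<Rightarrow> 'a \<Rightarrow> 'a set" where
  "principal_fractional D x = {x * d | d. d \<in> D}"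

definition is_principal :: "'a::field set \<Rightarrow> 'a set \<Rightarrow> bool" where
  "is_principal D I \<longleftrightarrow> (\<exists>x. I = principal_fractional D x)"

definition finitely_generated :: "'a::field set \<Rightarrow> 'a set \<Rightarrow> bool" where
  "finitely_generated D J \<longleftrightarrow> (\<exists>F. finite F \<and> J = span_over D (*) F)"

definition ideal_mult :: "'a::field set \<Rightarrow> 'a set \<Rightarrow> 'a set \<Rightarrow> 'a set" where
  "ideal_mult D I J = span_over D (*) {x * y | x y. x \<in> I \<and> y \<in> J}"

definition ideal_inverse :: "'a::field set \<Rightarrow> 'a set \<Rightarrow> 'a set" where
  "ideal_inverse D I = {x. \<forall>y\<in>I. x * y \<in> D}"

definition v_closure :: "'a::field set \<Rightarrow> 'a set \<Rightarrow> 'a set" where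
  "v_closure D I = ideal_inverse D (ideal_inverse D I)"

definition t_closure :: "'a::field set \<Rightarrow> 'a set \<Rightarrow> 'a set" where
  "t_closure D I = \<Union>{v_closure D J | J. finitely_generated D J \<and> J \<noteq> {0} \<and> J \<subseteq> I}"

definition t_ideal :: "'a::field set \<Rightarrow> 'a set \<Rightarrow> bool" where
  "t_ideal D I \<longleftrightarrow> fractional_ideal D I \<and> I \<noteq> {0} \<and> t_closure D I = I"

definition t_invertible :: "'a::field set \<Rightarrow> 'a set \<Rightarrow> bool" where
  "t_invertible D I \<longleftrightarrow> t_closure D (ideal_mult D I (ideal_inverse D I)) = D"

subsection \<open>The \<open>t\<close>-class group\<close>

definition t_ideal_group :: "'a::field set \<Rightarrow> 'a set monoid" where
  "t_ideal_group D =
     \<lparr>carrier = {I. t_ideal D I \<and> t_invertible D I},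
      monoid.mult = (\<lambda>I J. t_closure D (ideal_mult D I J)), one = D\<rparr>"

definition principal_group :: "'a::field set \<Rightarrow> 'a set set" where
  "principal_group D = {principal_fractional D x | x. x \<noteq> 0}"

definition t_class_group :: "'a::field set \<Rightarrow> 'a set set monoid" where
  "t_class_group D = t_ideal_group D Mod principal_group D"

definition t_class :: "'a::field set \<Rightarrow> 'a set \<Rightarrow> 'a set set" where
  "t_class D I = principal_group D #>\<^bsub>t_ideal_group D\<^esub> I"

subsection \<open>Integer-valued polynomials\<close>

definition Int_poly :: "'a::field set \<Rightarrow> 'a poly set" where
  "Int_poly D = {f. \<forall>x\<in>D. poly f x \<in> D}"

definition Int_poly_deg :: "'a::field set \<Rightarrow> nat \<Rightarrow> 'a poly set" where
  "Int_poly_deg D n = {f \<in> Int_poly D. degree f \<le> n}"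

definition polys_over :: "'a::field set \<Rightarrow> 'a poly set" where
  "polys_over D = {f. \<forall>i. coeff f i \<in> D}"

definition char_ideal :: "'a::field set \<Rightarrow> nat \<Rightarrow> 'a set" where
  "char_ideal D n = {coeff f n | f. f \<in> Int_poly_deg D n}"

definition factorial_ideal :: "'a::field set \<Rightarrow> nat \<Rightarrow> 'a set" where
  "factorial_ideal D n = ideal_inverse D (char_ideal D n)"

definition poly_conductor :: "'a::field set \<Rightarrow> 'a poly set \<Rightarrow> 'a set" where
  "poly_conductor D M = {r \<in> D. \<forall>f\<in>M. Polynomial.smult r f \<in> polys_over D}"

definition has_regular_basis :: "'a::field set \<Rightarrow> bool" where
  "has_regular_basis D \<longleftrightarrow>
     (\<exists>B. module_basis D Polynomial.smult (Int_poly D) B \<and> (\<forall>n. \<exists>!f. f \<in> B \<and> degree f = n))"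

definition POG :: "'a::field set \<Rightarrow> 'a set set set" where
  "POG D = generate (t_class_group D) (range (\<lambda>n. t_class D (char_ideal D n)))"

definition polynomially_L_regular :: "'a::field set \<Rightarrow> bool" where
  "polynomially_L_regular D \<longleftrightarrow>
     (\<forall>S. multiplicative_subset D S \<longrightarrow>
        localization S Polynomial.smult (Int_poly D) = Int_poly (localization S (*) D))"

end

theory Submission
  imports Defs
begin

text \<open>
  Write \<open>I\<^sub>n\<close> for the \<open>n\<close>th characteristic ideal. If \<open>I\<^sub>n\<close> is \<open>t\<close>-invertible, then it is invertible.
  Indeed \<open>I\<^sub>n I\<^sub>n\<^sup>-\<^sup>1\<close> contains a finite set \<open>G\<close> with \<open>G\<^sup>-\<^sup>1 = D\<close>, and comparing \<open>f(jX)\<close> with \<open>j\<^sup>n f(X)\<close>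
  shows that the coefficients of \<open>f\<close> have denominators dividing a power of \<open>j\<close> times an element
  of \<open>1 + jD\<close>, for each \<open>j \<in> G\<close>; the powers of \<open>j\<close> can be dropped because \<open>G\<^sup>-\<^sup>1 = D\<close>.

  That all coefficients of \<open>f\<close> lie in the characteristic ideal of its degree follows by induction on
  the degree, cancelling the leading term of \<open>f\<close> against \<open>X g\<close> with \<open>g\<close> of degree one less. If \<open>P\<close> is prime, some
  product \<open>a x\<close> with \<open>a \<in> I\<^sub>n\<close> and \<open>x \<in> I\<^sub>n\<^sup>-\<^sup>1\<close> lies outside \<open>P\<close>, and then \<open>a\<close> generates the
  localization of \<open>I\<^sub>n\<close> at \<open>P\<close>.
\<close>

subsection \<open>Fractional ideals and divisorial closure\<close>

lemma ring_on_simps [simp]: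
  "carrier (ring_on D) = D" "x \<otimes>\<^bsub>ring_on D\<^esub> y = x * y" "\<one>\<^bsub>ring_on D\<^esub> = 1"
  "\<zero>\<^bsub>ring_on D\<^esub> = 0" "x \<oplus>\<^bsub>ring_on D\<^esub> y = x + y"
  by (simp_all add: ring_on_def)

lemma field_module_simps [simp]:
  "carrier field_module = UNIV" "\<zero>\<^bsub>field_module\<^esub> = 0" "x \<oplus>\<^bsub>field_module\<^esub> y = x + y"
  "x \<odot>\<^bsub>field_module\<^esub> y = x * y"
  by (simp_all add: field_module_def)

lemma a_inv_field_module: "inv\<^bsub>add_monoid field_module\<^esub> x = - x"
  unfolding m_inv_def by (rule the_equality) (auto simp: field_module_def minus_unique)

text \<open>The bare set of products, with no sums taken. Inverses and v-closures do not distinguish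
  it from the ideal product, so the group law can be computed on elements.\<close>

definition products :: "'a::field set \<Rightarrow> 'a set \<Rightarrow> 'a set" where
  "products X Y = {x * y | x y. x \<in> X \<and> y \<in> Y}"

lemma productsI: "x \<in> X \<Longrightarrow> y \<in> Y \<Longrightarrow> x * y \<in> products X Y"
  by (auto simp: products_def)

lemma finite_products:
  assumes "finite X" "finite Y"
  shows "finite (products X Y)"
proof -
  have "products X Y = (\<lambda>(x, y). x * y) ` (X \<times> Y)"
    by (auto simp: products_def)
  then show ?thesis
    using assms by simp
qed

lemma products_mono: "X \<subseteq> X' \<Longrightarrow> Y \<subseteq> Y' \<Longrightarrow> products X Y \<subseteq> products X' Y'"
  by (auto simp: products_def)

section \<open>Spans with an arbitrary scalar multiplication\<close>

lemma span_over_add: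
  fixes R :: "'a::ring set"
  assumes zero: "0 \<in> R" and add: "\<And>a b. a \<in> R \<Longrightarrow> b \<in> R \<Longrightarrow> a + b \<in> R"
    and scale0: "\<And>x. scale 0 x = 0" and distrib: "\<And>a b x. scale (a + b) x = scale a x + scale b x"
    and x: "x \<in> span_over R scale B" and y: "y \<in> span_over R scale B"
  shows "x + y \<in> span_over R scale B"
proof -
  obtain F c where F: "finite F" "F \<subseteq> B" "c ` F \<subseteq> R" "x = (\<Sum>b\<in>F. scale (c b) b)"
    using x by (auto simp: span_over_def)
  obtain G e where G: "finite G" "G \<subseteq> B" "e ` G \<subseteq> R" "y = (\<Sum>b\<in>G. scale (e b) b)"
    using y by (auto simp: span_over_def)
  \<comment> \<open>The two combinations may have different supports; extending both coefficient
    functions by zero puts them on the common support \<open>F \<union> G\<close>.\<close>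
  define c' where "c' b = (if b \<in> F then c b else 0)" for b
  define e' where "e' b = (if b \<in> G then e b else 0)" for b
  have "x = (\<Sum>b\<in>F \<union> G. scale (c' b) b)" "y = (\<Sum>b\<in>F \<union> G. scale (e' b) b)"
    unfolding F(4) G(4)
    by (rule sum.mono_neutral_cong_left; use F G in \<open>auto simp: c'_def e'_def scale0\<close>)+
  then have "x + y = (\<Sum>b\<in>F \<union> G. scale (c' b + e' b) b)"
    by (simp add: distrib sum.distrib)
  moreover have "(\<lambda>b. c' b + e' b) ` (F \<union> G) \<subseteq> R"
    using F(3) G(3) zero by (auto simp: c'_def e'_def image_subset_iff intro!: add)
  moreover have "finite (F \<union> G)" "F \<union> G \<subseteq> B"
    using F(1,2) G(1,2) by auto
  ultimately show ?thesis
    unfolding span_over_def by (intro CollectI exI conjI)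
qed

lemma span_over_scaled_base:
  assumes "b \<in> B" "d \<in> R"
  shows "scale d b \<in> span_over R scale B"
  unfolding span_over_def using assms by (auto intro!: exI[of _ "{b}"] exI[of _ "\<lambda>_. d"])

lemma span_over_zero: "0 \<in> span_over R scale B"
  unfolding span_over_def by (auto intro!: exI[of _ "{}"])

section \<open>Submodules of the field over a subring\<close>

locale subring_on =
  fixes D :: "'a::field set"
  assumes zero_in [simp]: "0 \<in> D" and one_in [simp]: "1 \<in> D"
    and add_in: "x \<in> D \<Longrightarrow> y \<in> D \<Longrightarrow> x + y \<in> D"
    and uminus_in: "x \<in> D \<Longrightarrow> - x \<in> D"
    and mult_in: "x \<in> D \<Longrightarrow> y \<in> D \<Longrightarrow> x * y \<in> D"
begin

lemma diff_in: "x \<in> D \<Longrightarrow> y \<in> D \<Longrightarrow> x - y \<in> D"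
  using add_in[of x "- y"] uminus_in[of y] by simp

lemma power_in: "x \<in> D \<Longrightarrow> x ^ n \<in> D"
  by (induction n) (auto intro: mult_in)

lemma sum_in: "(\<And>i. i \<in> A \<Longrightarrow> f i \<in> D) \<Longrightarrow> sum f A \<in> D"
  by (induction A rule: infinite_finite_induct) (auto intro: add_in)

lemma prod_in: "(\<And>i. i \<in> A \<Longrightarrow> f i \<in> D) \<Longrightarrow> prod f A \<in> D"
  by (induction A rule: infinite_finite_induct) (auto intro: mult_in)

lemmas ring_in = add_in uminus_in mult_in diff_in power_in

definition submodule_on :: "'a set \<Rightarrow> bool" where
  "submodule_on I \<longleftrightarrow>
     0 \<in> I \<and> (\<forall>x\<in>I. \<forall>y\<in>I. x + y \<in> I) \<and> (\<forall>d\<in>D. \<forall>x\<in>I. d * x \<in> I)"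

lemma submodule_onI:
  assumes "0 \<in> I" "\<And>x y. x \<in> I \<Longrightarrow> y \<in> I \<Longrightarrow> x + y \<in> I" "\<And>d x. d \<in> D \<Longrightarrow> x \<in> I \<Longrightarrow> d * x \<in> I"
  shows "submodule_on I"
  using assms by (auto simp: submodule_on_def)

lemma submodule_onD:
  assumes "submodule_on I"
  shows "0 \<in> I" "\<And>x y. x \<in> I \<Longrightarrow> y \<in> I \<Longrightarrow> x + y \<in> I" "\<And>d x. d \<in> D \<Longrightarrow> x \<in> I \<Longrightarrow> d * x \<in> I"
  using assms by (auto simp: submodule_on_def)

text \<open>Closure under additive inverses comes for free, since negation is multiplication by the
  element -1 of \<open>D\<close>.\<close>

lemma submodule_iff: "submodule I (ring_on D) field_module \<longleftrightarrow> submodule_on I"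
proof
  assume "submodule I (ring_on D) field_module"
  then interpret submodule I "ring_on D" field_module .
  show "submodule_on I"
    using one_closed m_closed smult_closed by (auto intro!: submodule_onI)
next
  assume *: "submodule_on I"
  have "- x \<in> I" if "x \<in> I" for x
    using submodule_onD(3)[OF *, of "-1" x] that uminus_in[of 1] by simp
  then show "submodule I (ring_on D) field_module"
    unfolding submodule_def subgroup_def submodule_axioms_def a_inv_field_module
    using submodule_onD[OF *] by auto
qed

text \<open>Serves as an induction principle for spans: a property holds on the whole span once the
  elements having it form a submodule that contains the generators.\<close>

lemma span_over_minimal:
  assumes "submodule_on I" "B \<subseteq> I"
  shows "span_over D (*) B \<subseteq> I"
proof -
  have "(\<Sum>b\<in>F. c b * b) \<in> I" if "finite F" "F \<subseteq> B" "c ` F \<subseteq> D" for F c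
    using that
  proof (induction F)
    case (insert b F)
    then show ?case
      using assms by (auto intro!: submodule_onD[OF assms(1)])
  qed (simp add: submodule_onD[OF assms(1)])
  then show ?thesis
    by (auto simp: span_over_def)
qed

lemma submodule_on_span: "submodule_on (span_over D (*) B)"
proof (rule submodule_onI)
  fix d x assume "d \<in> D" "x \<in> span_over D (*) B"
  then obtain F c where F: "finite F" "F \<subseteq> B" "c ` F \<subseteq> D" "x = (\<Sum>b\<in>F. c b * b)"
    by (auto simp: span_over_def)
  have "d * x = (\<Sum>b\<in>F. (d * c b) * b)"
    by (simp add: F sum_distrib_left mult.assoc)
  moreover have "(\<lambda>b. d * c b) ` F \<subseteq> D"
    using F \<open>d \<in> D\<close> by (auto intro: mult_in)
  ultimately show "d * x \<in> span_over D (*) B"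
    unfolding span_over_def using F(1,2) by (intro CollectI exI conjI)
qed (auto intro!: span_over_add span_over_zero simp: distrib_right add_in)

lemma span_superset: "B \<subseteq> span_over D (*) B"
  using span_over_scaled_base[of _ B 1 D "(*)"] by auto

section \<open>Inverses and the v-closure\<close>

lemma submodule_on_inverse: "submodule_on (ideal_inverse D X)"
  by (rule submodule_onI) (auto simp: ideal_inverse_def distrib_right mult.assoc ring_in)

lemma ideal_inverse_antimono: "X \<subseteq> Y \<Longrightarrow> ideal_inverse D Y \<subseteq> ideal_inverse D X"
  by (auto simp: ideal_inverse_def)

lemma ideal_inverse_span [simp]: "ideal_inverse D (span_over D (*) X) = ideal_inverse D X"
proof
  show "ideal_inverse D (span_over D (*) X) \<subseteq> ideal_inverse D X"
    using span_superset by (rule ideal_inverse_antimono)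
  show "ideal_inverse D X \<subseteq> ideal_inverse D (span_over D (*) X)"
  proof
    fix x assume x: "x \<in> ideal_inverse D X"
    have "submodule_on {y. x * y \<in> D}"
    proof (rule submodule_onI)
      fix d y assume "d \<in> D" "y \<in> {y. x * y \<in> D}"
      then show "d * y \<in> {y. x * y \<in> D}"
        using mult_in[of d "x * y"] by (simp add: mult.left_commute)
    qed (auto simp: distrib_left add_in)
    then have "span_over D (*) X \<subseteq> {y. x * y \<in> D}"
      by (rule span_over_minimal) (use x in \<open>auto simp: ideal_inverse_def\<close>)
    then show "x \<in> ideal_inverse D (span_over D (*) X)"
      by (auto simp: ideal_inverse_def)
  qed
qed

lemma v_closure_superset: "X \<subseteq> v_closure D X"
  by (auto simp: v_closure_def ideal_inverse_def mult.commute)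

text \<open>Taking inverses is an antitone Galois connection, so three inversions amount to
  one.\<close>

lemma ideal_inverse_v_closure [simp]: "ideal_inverse D (v_closure D X) = ideal_inverse D X"
  using ideal_inverse_antimono[OF v_closure_superset[of X]]
    v_closure_superset[of "ideal_inverse D X"]
  by (simp add: v_closure_def)

lemma v_closure_mono: "X \<subseteq> Y \<Longrightarrow> v_closure D X \<subseteq> v_closure D Y"
  unfolding v_closure_def by (intro ideal_inverse_antimono)

lemma v_closure_idem [simp]: "v_closure D (v_closure D X) = v_closure D X"
  by (subst (1 3) v_closure_def) simp

lemma inverse_D [simp]: "ideal_inverse D D = D"
  using mult_in by (auto simp: ideal_inverse_def) (metis mult.right_neutral one_in)

lemma v_closure_D [simp]: "v_closure D D = D"
  by (simp add: v_closure_def)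

lemma v_closure_inverse [simp]: "v_closure D (ideal_inverse D X) = ideal_inverse D X"
  using ideal_inverse_v_closure[of X] by (simp add: v_closure_def)

lemma submodule_on_D: "submodule_on D"
  by (rule submodule_onI) (auto simp: ring_in)

section \<open>Products of sets and of ideals\<close>

lemma ideal_mult_eq: "ideal_mult D X Y = span_over D (*) (products X Y)"
  by (simp add: ideal_mult_def products_def)

lemma products_commute: "products X Y = products Y X"
proof -
  have "products X Y = {y * x | x y. x \<in> X \<and> y \<in> Y}"
    unfolding products_def by (simp add: mult.commute)
  then show ?thesis
    unfolding products_def by blast
qed

lemma products_assoc: "products (products X Y) Z = products X (products Y Z)"
proof -
  have "products (products X Y) Z = {x * y * z | x y z. x \<in> X \<and> y \<in> Y \<and> z \<in> Z}"
    unfolding products_def by blast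
  moreover have "products X (products Y Z) = {x * (y * z) | x y z. x \<in> X \<and> y \<in> Y \<and> z \<in> Z}"
    unfolding products_def by blast
  ultimately show ?thesis
    by (simp add: mult.assoc)
qed

lemma mem_inverse_products_iff:
  "z \<in> ideal_inverse D (products X Y) \<longleftrightarrow> (\<forall>x\<in>X. z * x \<in> ideal_inverse D Y)"
  by (auto simp: ideal_inverse_def products_def mult.assoc)

lemma mem_inverse_productsI:
  "(\<And>x y. x \<in> X \<Longrightarrow> y \<in> Y \<Longrightarrow> z * (x * y) \<in> D) \<Longrightarrow> z \<in> ideal_inverse D (products X Y)"
  by (auto simp: ideal_inverse_def products_def)

lemma ideal_inverse_ideal_mult [simp]:
  "ideal_inverse D (ideal_mult D X Y) = ideal_inverse D (products X Y)"
  by (simp add: ideal_mult_eq)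

lemma v_closure_ideal_mult [simp]: "v_closure D (ideal_mult D X Y) = v_closure D (products X Y)"
  by (simp add: v_closure_def)

text \<open>An element \<open>z\<close> lies in the inverse of the products iff \<open>z * x\<close>
  is in the inverse of \<open>Y\<close> for all \<open>x\<close> in \<open>X\<close>, and
  \<open>Y\<close> has the same inverse as its v-closure. This makes multiplication followed by
  v-closure associative.\<close>

lemma v_closure_products_v_closure:
  "v_closure D (products X (v_closure D Y)) = v_closure D (products X Y)"
  "v_closure D (products (v_closure D Y) X) = v_closure D (products Y X)"
proof -
  have "ideal_inverse D (products X (v_closure D Y)) = ideal_inverse D (products X Y)"
    by (auto simp: mem_inverse_products_iff)
  then show "v_closure D (products X (v_closure D Y)) = v_closure D (products X Y)"
    by (simp add: v_closure_def)
  then show "v_closure D (products (v_closure D Y) X) = v_closure D (products Y X)"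
    by (simp add: products_commute)
qed

lemma products_inverse_subset: "products X (ideal_inverse D X) \<subseteq> D"
  by (auto simp: products_def ideal_inverse_def mult.commute)

lemma submodule_on_ideal_mult: "submodule_on (ideal_mult D X Y)"
  by (simp add: ideal_mult_eq submodule_on_span)

lemma ideal_mult_inverse_subset: "ideal_mult D X (ideal_inverse D X) \<subseteq> D"
  unfolding ideal_mult_eq by (rule span_over_minimal[OF submodule_on_D products_inverse_subset])

lemma v_closure_subset_D: "X \<subseteq> D \<Longrightarrow> v_closure D X \<subseteq> D"
  using v_closure_mono[of X D] by simp

text \<open>Each element of \<open>F\<close> is a finite combination of products, so it suffices to
  collect the left and right factors of all products that occur.\<close>

lemma finite_subset_span_products:
  assumes "finite F" "F \<subseteq> span_over D (*) (products X Y)"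
  shows "\<exists>A B. finite A \<and> finite B \<and> A \<subseteq> X \<and> B \<subseteq> Y \<and> F \<subseteq> span_over D (*) (products A B)"
  using assms
proof (induction F)
  case (insert x F)
  then obtain A B where AB: "finite A" "finite B" "A \<subseteq> X" "B \<subseteq> Y"
      "F \<subseteq> span_over D (*) (products A B)"
    by auto
  from insert.prems obtain G c where G: "finite G" "G \<subseteq> products X Y" "c ` G \<subseteq> D"
      "x = (\<Sum>b\<in>G. c b * b)"
    by (auto simp: span_over_def)
  have "\<forall>g\<in>G. \<exists>a b. a \<in> X \<and> b \<in> Y \<and> g = a * b"
    using G(2) unfolding products_def by blast
  then obtain a b where ab: "\<And>g. g \<in> G \<Longrightarrow> a g \<in> X \<and> b g \<in> Y \<and> g = a g * b g"
    by metis
  have sub: "span_over D (*) U \<subseteq> span_over D (*) V" if "U \<subseteq> V" for U V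
    using that span_superset[of V] by (intro span_over_minimal[OF submodule_on_span]) auto
  have "x \<in> span_over D (*) (products (A \<union> a ` G) (B \<union> b ` G))"
  proof -
    have "G \<subseteq> products (A \<union> a ` G) (B \<union> b ` G)"
    proof
      fix g assume "g \<in> G"
      then have "a g * b g \<in> products (A \<union> a ` G) (B \<union> b ` G)"
        by (intro productsI) auto
      then show "g \<in> products (A \<union> a ` G) (B \<union> b ` G)"
        using ab[OF \<open>g \<in> G\<close>] by simp
    qed
    then show ?thesis
      unfolding span_over_def using G by (intro CollectI exI conjI)
  qed
  moreover have "F \<subseteq> span_over D (*) (products (A \<union> a ` G) (B \<union> b ` G))"
    using AB(5) sub[OF products_mono[of A "A \<union> a ` G" B "B \<union> b ` G"]] by blast
  moreover have "A \<union> a ` G \<subseteq> X" "B \<union> b ` G \<subseteq> Y"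
    using AB ab by auto
  ultimately show ?case
    using AB G by (intro exI[of _ "A \<union> a ` G"] exI[of _ "B \<union> b ` G"]) auto
qed auto

subsection \<open>Characteristic ideals\<close>

lemma submodule_on_coimage:
  assumes "submodule_on I"
  shows "submodule_on {y. z * y \<in> I}"
proof (rule submodule_onI)
  fix d y assume "d \<in> D" "y \<in> {y. z * y \<in> I}"
  then show "d * y \<in> {y. z * y \<in> I}"
    using submodule_onD(3)[OF assms, of d "z * y"] by (simp add: mult.left_commute)
qed (auto simp: distrib_left submodule_onD[OF assms])

lemma products_subset_ideal_mult: "products X Y \<subseteq> ideal_mult D X Y"
  unfolding ideal_mult_eq by (rule span_superset)

text \<open>For \<open>z\<close> in the v-closure and \<open>y\<close> in the inverse,
  \<open>z * y\<close> is in \<open>D\<close>, hence \<open>z * x * y\<close> is in \<open>I\<close>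
  for every \<open>x\<close> in \<open>I\<close>. As 1 is a combination of such products
  \<open>x * y\<close>, also \<open>z\<close> is in \<open>I\<close>.\<close>

lemma invertible_imp_divisorial:
  assumes "submodule_on I" "1 \<in> ideal_mult D I (ideal_inverse D I)"
  shows "v_closure D I = I"
proof
  show "v_closure D I \<subseteq> I"
  proof
    fix z assume z: "z \<in> v_closure D I"
    have "z * (x * y) \<in> I" if "x \<in> I" "y \<in> ideal_inverse D I" for x y
    proof -
      have "z * y \<in> D"
        using z that(2) by (auto simp: v_closure_def ideal_inverse_def)
      then have "z * y * x \<in> I"
        using submodule_onD(3)[OF assms(1)] that(1) by blast
      then show ?thesis
        by (simp add: mult_ac)
    qed
    then have "ideal_mult D I (ideal_inverse D I) \<subseteq> {y. z * y \<in> I}"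
      unfolding ideal_mult_eq
      by (intro span_over_minimal submodule_on_coimage assms(1)) (auto simp: products_def)
    then show "z \<in> I"
      using assms(2) by auto
  qed
qed (rule v_closure_superset)

text \<open>The t-closure is a union, so 1 already lies in the v-closure of one finitely generated
  submodule of the product, and finitely many factors span everything in it. Since the products of
  \<open>A\<close> and \<open>B\<close> lie in \<open>D\<close>, their inverse is then exactly
  \<open>D\<close>.\<close>

lemma t_invertible_finite:
  assumes "t_invertible D I"
  obtains A B where "finite A" "finite B" "A \<subseteq> I" "B \<subseteq> ideal_inverse D I"
    "ideal_inverse D (products A B) \<subseteq> D"
proof -
  have "1 \<in> t_closure D (ideal_mult D I (ideal_inverse D I))"
    using assms one_in unfolding t_invertible_def by simp
  then obtain F where F: "finite F" "1 \<in> v_closure D (span_over D (*) F)"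
      "span_over D (*) F \<subseteq> span_over D (*) (products I (ideal_inverse D I))"
    unfolding t_closure_def finitely_generated_def ideal_mult_eq by blast
  then obtain A B where AB: "finite A" "finite B" "A \<subseteq> I" "B \<subseteq> ideal_inverse D I"
      "F \<subseteq> span_over D (*) (products A B)"
    using finite_subset_span_products[of F I "ideal_inverse D I"] span_superset[of F] by blast
  have "ideal_inverse D (products A B) \<subseteq> ideal_inverse D F"
    using ideal_inverse_antimono[OF AB(5)] by simp
  moreover have "ideal_inverse D F \<subseteq> D"
    using F(2) by (auto simp: v_closure_def ideal_inverse_def[of D "ideal_inverse D F"])
  ultimately have "ideal_inverse D (products A B) \<subseteq> D"
    by (rule subset_trans)
  with AB(1-4) show thesis
    by (rule that)
qed

text \<open>Powers are removed one factor at a time. If \<open>z\<close> is not in \<open>D\<close>,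
  then some \<open>j * z\<close> is not in \<open>D\<close> either, but \<open>j * z\<close>
  satisfies the assumption with the exponent at \<open>j\<close> lowered by one; the sum of the
  exponents decreases.\<close>

lemma mem_of_power_mult_mem:
  assumes "finite G" "G \<subseteq> D" "ideal_inverse D G \<subseteq> D" "\<And>j. j \<in> G \<Longrightarrow> j ^ N j * z \<in> D"
  shows "z \<in> D"
  using assms(4)
proof (induction "\<Sum>j\<in>G. N j" arbitrary: N z rule: less_induct)
  case less
  show ?case
  proof (rule ccontr)
    assume z: "z \<notin> D"
    then have "z \<notin> ideal_inverse D G"
      using assms(3) by blast
    then obtain j where j: "j \<in> G" "j * z \<notin> D"
      by (auto simp: ideal_inverse_def mult.commute)
    \<comment> \<open>Exponent 0 at \<open>j\<close> would already put \<open>z\<close> into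
      \<open>D\<close>.\<close>
    then obtain k where k: "N j = Suc k"
      using less.prems[of j] z by (cases "N j") auto
    let ?N = "N(j := k)"
    have "(\<Sum>i\<in>G. ?N i) < (\<Sum>i\<in>G. N i)"
      using assms(1) j(1) k by (intro sum_strict_mono_ex1) auto
    moreover have "i ^ ?N i * (j * z) \<in> D" if "i \<in> G" for i
    proof (cases "i = j")
      case True
      then show ?thesis
        using less.prems[OF j(1)] k by (simp add: mult_ac)
    next
      case False
      then have "j * (i ^ N i * z) \<in> D"
        using less.prems[OF that] j(1) assms(2) mult_in by blast
      then show ?thesis
        using False by (simp add: mult_ac)
    qed
    ultimately have "j * z \<in> D"
      by (rule less.hyps)
    with j show False
      by simp
  qed
qed

section \<open>Integer-valued polynomials of bounded degree\<close>

lemma mem_Int_poly_deg: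
  "f \<in> Int_poly_deg D n \<longleftrightarrow> (\<forall>x\<in>D. poly f x \<in> D) \<and> degree f \<le> n"
  by (auto simp: Int_poly_deg_def Int_poly_def)

lemma Int_poly_deg_add: "f \<in> Int_poly_deg D n \<Longrightarrow> g \<in> Int_poly_deg D n \<Longrightarrow> f + g \<in> Int_poly_deg D n"
  by (auto simp: mem_Int_poly_deg ring_in degree_add_le)

lemma Int_poly_deg_smult:
  "d \<in> D \<Longrightarrow> f \<in> Int_poly_deg D n \<Longrightarrow> Polynomial.smult d f \<in> Int_poly_deg D n"
  by (auto simp: mem_Int_poly_deg ring_in intro: order_trans[OF degree_smult_le])

lemma Int_poly_deg_pCons_0: "f \<in> Int_poly_deg D n \<Longrightarrow> pCons 0 f \<in> Int_poly_deg D (Suc n)"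
  using degree_pCons_le[of 0 f] by (auto simp: mem_Int_poly_deg ring_in)

lemma Int_poly_deg_drop:
  assumes "f \<in> Int_poly_deg D (Suc n)" "coeff f (Suc n) = 0"
  shows "f \<in> Int_poly_deg D n"
proof -
  have "coeff f i = 0" if "i > n" for i
    using assms that by (cases "i = Suc n") (auto simp: mem_Int_poly_deg coeff_eq_0)
  then show ?thesis
    using assms by (auto simp: mem_Int_poly_deg degree_le)
qed

lemma coeff_Int_poly_deg_0:
  assumes "f \<in> Int_poly_deg D 0"
  shows "coeff f i \<in> D"
proof (cases i)
  case 0
  have "poly f 0 \<in> D"
    using assms by (simp add: mem_Int_poly_deg)
  then show ?thesis
    using 0 by (simp add: poly_0_coeff_0)
next
  case (Suc k)
  then show ?thesis
    using assms by (simp add: mem_Int_poly_deg coeff_eq_0)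
qed

text \<open>Congruence to 1 modulo \<open>I\<close> is multiplicative, by 1 - uv = (1 - u) + u(1 -
  v).\<close>

lemma one_diff_mult_mem:
  assumes "submodule_on I" "u \<in> D" "1 - u \<in> I" "1 - v \<in> I"
  shows "1 - u * v \<in> I"
proof -
  have "(1 - u) + u * (1 - v) \<in> I"
    using assms submodule_onD[OF assms(1)] by blast
  then show ?thesis
    by (simp add: algebra_simps)
qed

lemma one_diff_prod_mem:
  assumes "submodule_on I" "finite G" "\<And>j. j \<in> G \<Longrightarrow> u j \<in> D" "\<And>j. j \<in> G \<Longrightarrow> 1 - u j \<in> I"
  shows "1 - prod u G \<in> I"
  using assms(2-)
  by (induction G)
     (auto simp: submodule_onD[OF assms(1)] intro!: one_diff_mult_mem[OF assms(1)])

lemma submodule_on_principal: "submodule_on (principal_fractional D x)"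
proof (rule submodule_onI)
  show "0 \<in> principal_fractional D x"
    by (auto simp: principal_fractional_def intro!: exI[of _ 0])
next
  fix y z assume "y \<in> principal_fractional D x" "z \<in> principal_fractional D x"
  then obtain d e where "y = x * d" "z = x * e" "d \<in> D" "e \<in> D"
    by (auto simp: principal_fractional_def)
  then show "y + z \<in> principal_fractional D x"
    by (auto simp: principal_fractional_def ring_in intro!: exI[of _ "d + e"] simp: distrib_left)
next
  fix d y assume "d \<in> D" "y \<in> principal_fractional D x"
  then obtain e where "y = x * e" "d \<in> D" "e \<in> D"
    by (auto simp: principal_fractional_def)
  then show "d * y \<in> principal_fractional D x"
    by (auto simp: principal_fractional_def ring_in intro!: exI[of _ "d * e"])
qed

text \<open>
  The passage from \<open>f\<close> to \<open>f(jX) - j\<^sup>n f(X)\<close> lowers the degree and multiplies the coefficient of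
  \<open>X\<^sup>i\<close> by \<open>j\<^sup>i (1 - j\<^bsup>n-i\<^esup>)\<close>.
\<close>

lemma power_mult_coeff_mem:
  assumes j: "j \<in> D"
  shows "\<exists>N. \<exists>u\<in>D. 1 - u \<in> principal_fractional D j \<and>
    (\<forall>f\<in>Int_poly_deg D n. \<forall>i. j ^ N * u * coeff f i \<in> D)"
proof (induction n)
  case 0
  show ?case
    using coeff_Int_poly_deg_0 submodule_onD(1)[OF submodule_on_principal, of j]
    by (intro exI[of _ 0] bexI[of _ 1]) auto
next
  case (Suc n)
  then obtain N u where u: "u \<in> D" "1 - u \<in> principal_fractional D j"
      and Nu: "\<And>f i. f \<in> Int_poly_deg D n \<Longrightarrow> j ^ N * u * coeff f i \<in> D"
    by blast
  \<comment> \<open>For i \<le> n the factor j^i - j^(n+1) equals j^i (1 - j^(n+1-i)), with n+1-i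
    between 1 and n+1; so \<open>w\<close> is a multiple of every 1 - j^(n+1-i) that occurs.\<close>
  define w where "w = (\<Prod>k\<in>{1..Suc n}. 1 - j ^ k)"
  have in_D: "1 - j ^ k \<in> D" for k
    using j by (auto intro: ring_in)
  have w: "w \<in> D"
    unfolding w_def by (intro prod_in in_D)
  have "1 - (1 - j ^ k) \<in> principal_fractional D j" if "k \<in> {1..Suc n}" for k
    using that j by (cases k) (auto simp: principal_fractional_def intro: ring_in)
  then have w1: "1 - w \<in> principal_fractional D j"
    unfolding w_def by (intro one_diff_prod_mem submodule_on_principal in_D) auto
  have "j ^ (N + Suc n) * (u * w) * coeff f i \<in> D" if f: "f \<in> Int_poly_deg D (Suc n)" for f i
  proof -
    define g where "g = pcompose f [:0, j:] - Polynomial.smult (j ^ Suc n) f"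
    have deg: "degree f \<le> Suc n" and val: "\<And>x. x \<in> D \<Longrightarrow> poly f x \<in> D"
      using f by (auto simp: mem_Int_poly_deg)
    have coeff_g: "coeff g i = (j ^ i - j ^ Suc n) * coeff f i" for i
      by (simp add: g_def coeff_pcompose_linear algebra_simps)
    have "degree g \<le> n"
    proof (intro degree_le allI impI)
      fix i assume "i > n"
      then have "i = Suc n \<or> i > degree f"
        using deg by linarith
      then show "coeff g i = 0"
        by (auto simp: coeff_g coeff_eq_0)
    qed
    moreover have "poly g x \<in> D" if "x \<in> D" for x
      using val j that unfolding g_def poly_diff poly_smult poly_pcompose
      by (intro diff_in mult_in power_in) (auto intro: ring_in)
    ultimately have g: "g \<in> Int_poly_deg D n"
      by (auto simp: mem_Int_poly_deg)
    have low: "j ^ (N + Suc n) * (u * w) * coeff f i \<in> D" if "i \<le> n" for i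
    proof -
      define m where "m = Suc n - i"
      have m: "m \<in> {1..Suc n}" "Suc n = i + m"
        using that by (auto simp: m_def)
      define w' where "w' = (\<Prod>k\<in>{1..Suc n} - {m}. 1 - j ^ k)"
      have w_eq: "w = (1 - j ^ m) * w'"
        unfolding w_def w'_def using m by (intro prod.remove) auto
      have "w' \<in> D"
        unfolding w'_def by (intro prod_in in_D)
      \<comment> \<open>The factor \<open>w'\<close> completes 1 - j^m to \<open>w\<close>, and
        \<open>j ^ m\<close> completes j^i to j^(n+1), a power that does not depend on
        \<open>i\<close>.\<close>
      then have "j ^ m * w' * (j ^ N * u * coeff g i) \<in> D"
        by (intro mult_in[OF mult_in[OF power_in[OF j]] Nu[OF g]])
      also have "j ^ m * w' * (j ^ N * u * coeff g i) = j ^ (N + Suc n) * (u * w) * coeff f i"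
        unfolding coeff_g w_eq m(2) by (simp add: power_add algebra_simps)
      finally show ?thesis .
    qed
    \<comment> \<open>The coefficient of X^(n+1) is lost in \<open>g\<close>. It is recovered from
      the lower ones through the value of \<open>f\<close> at 1, which is in
      \<open>D\<close>.\<close>
    have "poly f 1 = (\<Sum>i\<le>Suc n. coeff f i)"
      unfolding poly_altdef using deg by (simp del: sum.atMost_Suc) (intro sum.mono_neutral_left; auto simp: coeff_eq_0)
    then have top: "coeff f (Suc n) = poly f 1 - (\<Sum>i\<le>n. coeff f i)"
      by simp
    have "j ^ (N + Suc n) * (u * w) * coeff f (Suc n) =
        j ^ (N + Suc n) * (u * w) * poly f 1 - (\<Sum>i\<le>n. j ^ (N + Suc n) * (u * w) * coeff f i)"
      unfolding top by (simp add: right_diff_distrib sum_distrib_left)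
    also have "\<dots> \<in> D"
      by (intro diff_in sum_in low mult_in[OF mult_in[OF power_in[OF j] mult_in[OF u(1) w]]] val) auto
    finally have "j ^ (N + Suc n) * (u * w) * coeff f (Suc n) \<in> D" .
    moreover have "coeff f i = 0" if "i > Suc n"
      using that deg by (simp add: coeff_eq_0)
    ultimately show ?thesis
      using low[of i] by (cases i "Suc n" rule: linorder_cases) auto
  qed
  moreover have "1 - u * w \<in> principal_fractional D j"
    using one_diff_mult_mem[OF submodule_on_principal u w1] .
  ultimately show ?case
    using u w by (intro exI[of _ "N + Suc n"] bexI[of _ "u * w"]) (auto intro: mult_in)
qed

lemma submodule_on_char_ideal: "submodule_on (char_ideal D n)"
proof (rule submodule_onI)
  have "0 \<in> Int_poly_deg D n"
    by (simp add: mem_Int_poly_deg)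
  then show "0 \<in> char_ideal D n"
    unfolding char_ideal_def by force
next
  fix x y assume "x \<in> char_ideal D n" "y \<in> char_ideal D n"
  then obtain f g where "x = coeff f n" "y = coeff g n" "f \<in> Int_poly_deg D n" "g \<in> Int_poly_deg D n"
    by (auto simp: char_ideal_def)
  then show "x + y \<in> char_ideal D n"
    using Int_poly_deg_add[of f n g] by (auto simp: char_ideal_def intro!: exI[of _ "f + g"])
next
  fix d x assume "d \<in> D" "x \<in> char_ideal D n"
  then obtain f where "x = coeff f n" "f \<in> Int_poly_deg D n"
    by (auto simp: char_ideal_def)
  then show "d * x \<in> char_ideal D n"
    using Int_poly_deg_smult[OF \<open>d \<in> D\<close>, of f n]
    by (auto simp: char_ideal_def intro!: exI[of _ "Polynomial.smult d f"])
qed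

lemma coeff_mem_char_ideal: "f \<in> Int_poly_deg D n \<Longrightarrow> coeff f n \<in> char_ideal D n"
  by (auto simp: char_ideal_def)

lemma one_mem_char_ideal: "1 \<in> char_ideal D n"
proof -
  have "monom 1 n \<in> Int_poly_deg D n"
    by (auto simp: mem_Int_poly_deg poly_monom power_in degree_monom_le)
  then show ?thesis
    using coeff_mem_char_ideal by fastforce
qed

lemma char_ideal_mono_Suc: "char_ideal D n \<subseteq> char_ideal D (Suc n)"
proof
  fix x assume "x \<in> char_ideal D n"
  then obtain f where "x = coeff (pCons 0 f) (Suc n)" "f \<in> Int_poly_deg D n"
    by (auto simp: char_ideal_def)
  then show "x \<in> char_ideal D (Suc n)"
    using Int_poly_deg_pCons_0 coeff_mem_char_ideal by blast
qed

text \<open>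
  Let \<open>G\<close> be a finite set of products from \<open>I I\<^sup>-\<^sup>1\<close> with \<open>G\<^sup>-\<^sup>1 = D\<close>. Modulo \<open>I I\<^sup>-\<^sup>1\<close> the factor
  \<open>u\<close> below is congruent to 1, while \<open>u c\<close> is multiplied into \<open>D\<close> by a power of each element of \<open>G\<close>
  for every \<open>c \<in> I\<close>; hence \<open>u\<close> itself is in \<open>I\<^sup>-\<^sup>1\<close>.
\<close>

lemma char_ideal_invertible:
  assumes "t_invertible D (char_ideal D n)"
  shows "1 \<in> ideal_mult D (char_ideal D n) (ideal_inverse D (char_ideal D n))"
proof -
  let ?I = "char_ideal D n"
  let ?A = "ideal_mult D ?I (ideal_inverse D ?I)"
  obtain A B where AB: "finite A" "finite B" "A \<subseteq> ?I" "B \<subseteq> ideal_inverse D ?I"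
      "ideal_inverse D (products A B) \<subseteq> D"
    using t_invertible_finite[OF assms] .
  define G where "G = products A B"
  have G_A: "G \<subseteq> ?A"
    unfolding G_def using products_mono[OF AB(3,4)] products_subset_ideal_mult by blast
  then have G: "finite G" "G \<subseteq> D"
    using AB finite_products ideal_mult_inverse_subset unfolding G_def by blast+
  have "\<forall>j\<in>G. \<exists>N u. u \<in> D \<and> 1 - u \<in> principal_fractional D j \<and>
      (\<forall>f\<in>Int_poly_deg D n. \<forall>i. j ^ N * u * coeff f i \<in> D)"
    using power_mult_coeff_mem G(2) by blast
  then obtain N u where u: "\<And>j. j \<in> G \<Longrightarrow> u j \<in> D"
      "\<And>j. j \<in> G \<Longrightarrow> 1 - u j \<in> principal_fractional D j"
      "\<And>j f i. j \<in> G \<Longrightarrow> f \<in> Int_poly_deg D n \<Longrightarrow> j ^ N j * u j * coeff f i \<in> D"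
    by metis
  let ?u = "prod u G"
  \<comment> \<open>As \<open>?A\<close> is a submodule containing \<open>G\<close>, congruence
    modulo any \<open>j\<close> in \<open>G\<close> implies congruence modulo
    \<open>?A\<close>.\<close>
  have "1 - u j \<in> ?A" if "j \<in> G" for j
    using u(2)[OF that] that G_A submodule_onD(3)[OF submodule_on_ideal_mult]
    by (auto simp: principal_fractional_def mult.commute)
  then have 1: "1 - ?u \<in> ?A"
    using one_diff_prod_mem[OF submodule_on_ideal_mult G(1)] u(1) by blast
  have "?u * c \<in> D" if c: "c \<in> ?I" for c
  proof (rule mem_of_power_mult_mem[OF G])
    show "ideal_inverse D G \<subseteq> D"
      using AB(5) by (simp add: G_def)
    fix j assume j: "j \<in> G"
    obtain f where f: "f \<in> Int_poly_deg D n" "c = coeff f n"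
      using c by (auto simp: char_ideal_def)
    \<comment> \<open>For a given \<open>j\<close> only the factor \<open>u j\<close> clears
      denominators; the remaining factors are elements of \<open>D\<close>.\<close>
    have "prod u (G - {j}) * (j ^ N j * u j * c) \<in> D"
      unfolding f(2) using u(1) by (intro mult_in[OF prod_in] u(3)[OF j f(1)]) auto
    also have "prod u (G - {j}) * (j ^ N j * u j * c) = j ^ N j * (?u * c)"
      using prod.remove[OF G(1) j, of u] by (simp add: mult_ac)
    finally show "j ^ N j * (?u * c) \<in> D" .
  qed
  then have "?u \<in> ideal_inverse D ?I"
    by (simp add: ideal_inverse_def)
  \<comment> \<open>Since 1 is in \<open>?I\<close>, as the leading coefficient of X^n, every
    element of the inverse is itself a product from \<open>?A\<close>.\<close>
  then have "1 * ?u \<in> ?A"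
    using productsI[OF one_mem_char_ideal] products_subset_ideal_mult by blast
  with 1 have "(1 - ?u) + 1 * ?u \<in> ?A"
    by (rule submodule_onD(2)[OF submodule_on_ideal_mult])
  then show ?thesis
    by simp
qed

text \<open>Writing 1 as a combination of products \<open>x * y\<close> makes \<open>z\<close> a
  combination of the elements \<open>z * (x * y)\<close>.\<close>

lemma mem_D_of_invertible:
  assumes "1 \<in> ideal_mult D X Y" "\<And>x y. x \<in> X \<Longrightarrow> y \<in> Y \<Longrightarrow> z * (x * y) \<in> D"
  shows "z \<in> D"
proof -
  have "ideal_mult D X Y \<subseteq> {w. z * w \<in> D}"
    unfolding ideal_mult_eq
    by (intro span_over_minimal submodule_on_coimage submodule_on_D)
       (use assms(2) in \<open>auto simp: products_def\<close>)
  then show ?thesis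
    using assms(1) by auto
qed

text \<open>
  If \<open>g\<close> has degree at most \<open>n\<close> with \<open>X\<^sup>n\<close>-coefficient \<open>u\<close> and \<open>f\<close> has degree at most \<open>n + 1\<close> with
  \<open>X\<^bsup>n+1\<^esup>\<close>-coefficient \<open>c\<close>, then \<open>c X g - u f\<close> has degree at most \<open>n\<close>, so the induction hypothesis
  applies to it as well as to \<open>g\<close>.
\<close>

theorem coeff_mem_char_ideal_of_invertible:
  assumes inv: "\<And>n. 1 \<in> ideal_mult D (char_ideal D n) (ideal_inverse D (char_ideal D n))"
    and "f \<in> Int_poly_deg D n"
  shows "coeff f i \<in> char_ideal D n"
  using assms(2)
proof (induction n arbitrary: f i)
  case 0
  then show ?case
    using submodule_onD[OF submodule_on_char_ideal, of 0] coeff_mem_char_ideal[OF 0]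
    by (cases i) (auto simp: mem_Int_poly_deg coeff_eq_0)
next
  case (Suc n)
  let ?I = "char_ideal D n" and ?J = "char_ideal D (Suc n)"
  \<comment> \<open>As \<open>?J\<close> is divisorial, membership of a coefficient in it can be
    tested by multiplying with the elements of its inverse.\<close>
  have "x * coeff f i \<in> D" if x: "x \<in> ideal_inverse D ?J" for x
  proof (rule mem_D_of_invertible[OF inv[of n]])
    fix u y assume u: "u \<in> ?I" and y: "y \<in> ideal_inverse D ?I"
    obtain g where g: "g \<in> Int_poly_deg D n" "u = coeff g n"
      using u by (auto simp: char_ideal_def)
    define c where "c = coeff f (Suc n)"
    have xc: "x * c \<in> D" and xu: "x * u \<in> D"
      using x u coeff_mem_char_ideal[OF Suc.prems] char_ideal_mono_Suc[of n]
      by (auto simp: ideal_inverse_def c_def)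
    \<comment> \<open>The elements \<open>c\<close> and \<open>u\<close> lie in \<open>?J\<close>
      and need not be in \<open>D\<close>, but after multiplication by \<open>x\<close> both are
      scalars from \<open>D\<close>. Hence the combination stays integer-valued.\<close>
    define h where "h = Polynomial.smult (x * c) (pCons 0 g) + Polynomial.smult (- (x * u)) f"
    have "h \<in> Int_poly_deg D (Suc n)"
      unfolding h_def using xc uminus_in[OF xu] g(1) Suc.prems
      by (intro Int_poly_deg_add Int_poly_deg_smult Int_poly_deg_pCons_0)
    moreover have "coeff h (Suc n) = 0"
      by (simp add: h_def c_def g)
    ultimately have "h \<in> Int_poly_deg D n"
      by (rule Int_poly_deg_drop)
    then have "coeff h i \<in> ?I"
      by (rule Suc.IH)
    moreover have "coeff (pCons 0 g) i \<in> ?I"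
      using Suc.IH[OF g(1)] submodule_onD(1)[OF submodule_on_char_ideal]
      by (auto simp: coeff_pCons split: nat.split)
    ultimately have "x * c * coeff (pCons 0 g) i + (- 1) * coeff h i \<in> ?I"
      using xc uminus_in[of 1] by (intro submodule_onD(2,3)[OF submodule_on_char_ideal]) auto
    also have "x * c * coeff (pCons 0 g) i + (- 1) * coeff h i = x * u * coeff f i"
      by (cases i) (simp_all add: h_def)
    finally have "y * (x * u * coeff f i) \<in> D"
      using y by (simp add: ideal_inverse_def)
    then show "x * coeff f i * (u * y) \<in> D"
      by (simp add: mult_ac)
  qed
  then have "coeff f i \<in> v_closure D ?J"
    by (simp add: v_closure_def ideal_inverse_def[of D "ideal_inverse D ?J"] mult.commute)
  then show ?case
    by (simp add: invertible_imp_divisorial[OF submodule_on_char_ideal inv])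
qed

subsection \<open>The \<open>t\<close>-class group\<close>

lemma mem_principal: "x \<in> principal_fractional D x"
  by (auto simp: principal_fractional_def intro!: exI[of _ 1])

lemma ideal_inverse_principal:
  assumes "x \<noteq> 0"
  shows "ideal_inverse D (principal_fractional D x) = principal_fractional D (inverse x)"
proof
  show "ideal_inverse D (principal_fractional D x) \<subseteq> principal_fractional D (inverse x)"
  proof
    fix z assume "z \<in> ideal_inverse D (principal_fractional D x)"
    then have "z * x \<in> D"
      using mem_principal by (auto simp: ideal_inverse_def)
    moreover have "z = inverse x * (z * x)"
      using assms by simp
    ultimately show "z \<in> principal_fractional D (inverse x)"
      unfolding principal_fractional_def by blast
  qed
  show "principal_fractional D (inverse x) \<subseteq> ideal_inverse D (principal_fractional D x)"
  proof (clarsimp simp: ideal_inverse_def principal_fractional_def)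
    fix d e assume "d \<in> D" "e \<in> D"
    then have "d * e \<in> D"
      by (rule mult_in)
    also have "d * e = inverse x * d * (x * e)"
      using assms by simp
    finally show "inverse x * d * (x * e) \<in> D" .
  qed
qed

lemma v_closure_principal: "x \<noteq> 0 \<Longrightarrow> v_closure D (principal_fractional D x) = principal_fractional D x"
  by (simp add: v_closure_def ideal_inverse_principal)

lemma products_principal:
  "products (principal_fractional D x) (principal_fractional D y) = principal_fractional D (x * y)"
proof
  show "products (principal_fractional D x) (principal_fractional D y) \<subseteq> principal_fractional D (x * y)"
  proof
    fix z assume "z \<in> products (principal_fractional D x) (principal_fractional D y)"
    then obtain d e where "d \<in> D" "e \<in> D" "z = x * d * (y * e)"
      by (auto simp: products_def principal_fractional_def)
    then show "z \<in> principal_fractional D (x * y)"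
      by (auto simp: principal_fractional_def mult_in intro!: exI[of _ "d * e"])
  qed
  show "principal_fractional D (x * y) \<subseteq> products (principal_fractional D x) (principal_fractional D y)"
  proof
    fix z assume "z \<in> principal_fractional D (x * y)"
    then obtain d where d: "d \<in> D" "z = x * (y * d)"
      by (auto simp: principal_fractional_def)
    then have "y * d \<in> principal_fractional D y"
      by (auto simp: principal_fractional_def)
    then show "z \<in> products (principal_fractional D x) (principal_fractional D y)"
      unfolding d(2) by (rule productsI[OF mem_principal])
  qed
qed

lemma principal_one [simp]: "principal_fractional D 1 = D"
  by (simp add: principal_fractional_def)

text \<open>Inversion preserves nonzero principal ideals and is an involution on divisorial ones.
  The nonzero elements exclude the generator 0.\<close>

lemma is_principal_ideal_inverse_iff:
  assumes "v_closure D I = I" "\<exists>a\<in>I. a \<noteq> 0" "\<exists>b\<in>ideal_inverse D I. b \<noteq> 0"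
  shows "is_principal D (ideal_inverse D I) \<longleftrightarrow> is_principal D I"
proof -
  have *: "is_principal D (ideal_inverse D J)" if "is_principal D J" "\<exists>a\<in>J. a \<noteq> 0" for J
    using that ideal_inverse_principal by (auto simp: is_principal_def principal_fractional_def)
  show ?thesis
    using *[of I] *[of "ideal_inverse D I"] assms by (auto simp: v_closure_def)
qed

text \<open>A finitary form of \<open>t\<close>-invertibility; it is symmetric in \<open>I\<close> and \<open>I\<^sup>-\<^sup>1\<close> when \<open>I\<close> is divisorial.\<close>

definition finitely_v_invertible :: "'a set \<Rightarrow> bool" where
  "finitely_v_invertible I \<longleftrightarrow> (\<exists>A B. finite A \<and> finite B \<and> A \<subseteq> I \<and> B \<subseteq> ideal_inverse D I \<and>
     ideal_inverse D (products A B) \<subseteq> D)"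

lemma finitely_v_invertibleI:
  assumes "finite A" "finite B" "A \<subseteq> I" "B \<subseteq> ideal_inverse D I" "ideal_inverse D (products A B) \<subseteq> D"
  shows "finitely_v_invertible I"
  using assms unfolding finitely_v_invertible_def by blast

lemma finitely_v_invertible_mono:
  assumes "finitely_v_invertible I" "I \<subseteq> J" "ideal_inverse D J = ideal_inverse D I"
  shows "finitely_v_invertible J"
  using assms unfolding finitely_v_invertible_def by (metis subset_trans)

lemma products_subset_D:
  assumes "A \<subseteq> I" "B \<subseteq> ideal_inverse D I"
  shows "products A B \<subseteq> D"
  using products_mono[OF assms] products_inverse_subset by blast

text \<open>The finite witnesses are multiplied factor by factor. An element of the inverse of all
  fourfold products is brought back to \<open>D\<close> by removing first the pair belonging to
  \<open>J\<close>, then the pair belonging to \<open>I\<close>.\<close>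

lemma finitely_v_invertible_products:
  assumes "finitely_v_invertible I" "finitely_v_invertible J"
  shows "finitely_v_invertible (products I J)"
proof -
  obtain A B where A: "finite A" "finite B" "A \<subseteq> I" "B \<subseteq> ideal_inverse D I"
      "ideal_inverse D (products A B) \<subseteq> D"
    using assms(1) unfolding finitely_v_invertible_def by blast
  obtain A' B' where A': "finite A'" "finite B'" "A' \<subseteq> J" "B' \<subseteq> ideal_inverse D J"
      "ideal_inverse D (products A' B') \<subseteq> D"
    using assms(2) unfolding finitely_v_invertible_def by blast
  show ?thesis
  proof (rule finitely_v_invertibleI)
    show "finite (products A A')" "finite (products B B')"
      using A A' by (simp_all add: finite_products)
    show "products A A' \<subseteq> products I J"
      using A A' by (intro products_mono)
    show "products B B' \<subseteq> ideal_inverse D (products I J)"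
    proof
      fix w assume "w \<in> products B B'"
      then obtain b b' where b: "b \<in> B" "b' \<in> B'" "w = b * b'"
        by (auto simp: products_def)
      have "w * (x * y) \<in> D" if "x \<in> I" "y \<in> J" for x y
      proof -
        have "(b * x) * (b' * y) \<in> D"
          by (rule mult_in; use b that A(4) A'(4) in \<open>auto simp: ideal_inverse_def\<close>)
        then show ?thesis
          by (simp add: b mult_ac)
      qed
      then show "w \<in> ideal_inverse D (products I J)"
        by (auto simp: ideal_inverse_def products_def)
    qed
    show "ideal_inverse D (products (products A A') (products B B')) \<subseteq> D"
    proof
      fix z assume z: "z \<in> ideal_inverse D (products (products A A') (products B B'))"
      have "z * (a * b) * (a' * b') \<in> D" if "a \<in> A" "b \<in> B" "a' \<in> A'" "b' \<in> B'" for a b a' b'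
      proof -
        have "z * ((a * a') * (b * b')) \<in> D"
          using z productsI[OF productsI[OF that(1,3)] productsI[OF that(2,4)]]
          by (simp add: ideal_inverse_def)
        then show ?thesis
          by (simp add: mult_ac)
      qed
      then have "z * (a * b) \<in> ideal_inverse D (products A' B')" if "a \<in> A" "b \<in> B" for a b
        using that by (intro mem_inverse_productsI)
      then have "z \<in> ideal_inverse D (products A B)"
        using A'(5) by (intro mem_inverse_productsI) blast
      then show "z \<in> D"
        using A(5) by blast
    qed
  qed
qed

lemma t_invertible_imp_finitely_v_invertible: "t_invertible D I \<Longrightarrow> finitely_v_invertible I"
  by (erule t_invertible_finite) (rule finitely_v_invertibleI)

lemma finitely_v_invertible_imp_t_invertible:
  assumes "finitely_v_invertible I" and a: "a \<in> I" "a \<noteq> 0" and b: "b \<in> ideal_inverse D I" "b \<noteq> 0"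
  shows "t_invertible D I"
proof -
  let ?A = "ideal_mult D I (ideal_inverse D I)"
  obtain A B where A: "finite A" "finite B" "A \<subseteq> I" "B \<subseteq> ideal_inverse D I"
      "ideal_inverse D (products A B) \<subseteq> D"
    using assms(1) unfolding finitely_v_invertible_def by blast
  \<comment> \<open>The nonzero elements \<open>a\<close> and \<open>b\<close> are added because the
    t-closure ranges over nonzero finitely generated submodules only.\<close>
  define F where "F = products (insert a A) (insert b B)"
  have F: "finite F" "F \<subseteq> D" "F \<subseteq> products I (ideal_inverse D I)"
    using A a b products_subset_D[of "insert a A" I "insert b B"]
      products_mono[of "insert a A" I "insert b B" "ideal_inverse D I"]
    unfolding F_def by (auto intro: finite_products)
  have "ideal_inverse D F \<subseteq> ideal_inverse D (products A B)"
    unfolding F_def by (intro ideal_inverse_antimono products_mono) auto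
  then have "ideal_inverse D F \<subseteq> D"
    using A(5) by blast
  from ideal_inverse_antimono[OF this] have "D \<subseteq> v_closure D (span_over D (*) F)"
    by (simp add: v_closure_def)
  moreover have "a * b \<in> span_over D (*) F"
    using span_superset[of F] by (auto simp: F_def intro: productsI)
  then have "span_over D (*) F \<noteq> {0}"
    using a(2) b(2) by (metis mult_eq_0_iff singletonD)
  moreover have "span_over D (*) F \<subseteq> ?A"
    using F(3) products_subset_ideal_mult by (intro span_over_minimal submodule_on_ideal_mult) blast
  moreover have "finitely_generated D (span_over D (*) F)"
    using F(1) unfolding finitely_generated_def by blast
  ultimately have "D \<subseteq> t_closure D ?A"
    unfolding t_closure_def by blast
  moreover have "t_closure D ?A \<subseteq> D"
    using v_closure_subset_D ideal_mult_inverse_subset[of I] unfolding t_closure_def by blast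
  ultimately show ?thesis
    by (simp add: t_invertible_def)
qed

text \<open>A finite part of \<open>I\<close> already has the inverse of \<open>I\<close>: if
  \<open>x\<close> multiplies \<open>A\<close> into \<open>D\<close>, then (xy)(cd) = (xc)(dy) is in
  \<open>D\<close> for \<open>c\<close> in \<open>A\<close>, \<open>d\<close> in \<open>B\<close>
  and \<open>y\<close> in \<open>I\<close>, so xy is in \<open>D\<close>. Thus the v-closure of
  \<open>I\<close> is attained in the union defining the t-closure.\<close>

lemma finitely_v_invertible_t_closure:
  assumes "finitely_v_invertible I" "submodule_on I" and a: "a \<in> I" "a \<noteq> 0"
  shows "t_closure D I = v_closure D I"
proof
  show "t_closure D I \<subseteq> v_closure D I"
    using v_closure_mono unfolding t_closure_def by blast
  obtain A B where A: "finite A" "finite B" "A \<subseteq> I" "B \<subseteq> ideal_inverse D I"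
      "ideal_inverse D (products A B) \<subseteq> D"
    using assms(1) unfolding finitely_v_invertible_def by blast
  have "ideal_inverse D (insert a A) \<subseteq> ideal_inverse D I"
  proof
    fix x assume x: "x \<in> ideal_inverse D (insert a A)"
    have "x * y \<in> D" if "y \<in> I" for y
    proof -
      have "x * y * (c * d) \<in> D" if "c \<in> A" "d \<in> B" for c d
      proof -
        have "(x * c) * (d * y) \<in> D"
          by (rule mult_in; use x that \<open>y \<in> I\<close> A(4) in \<open>auto simp: ideal_inverse_def\<close>)
        then show ?thesis
          by (simp add: mult_ac)
      qed
      then have "x * y \<in> ideal_inverse D (products A B)"
        by (auto simp: ideal_inverse_def products_def)
      then show ?thesis
        using A(5) by blast
    qed
    then show "x \<in> ideal_inverse D I"
      by (simp add: ideal_inverse_def)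
  qed
  from ideal_inverse_antimono[OF this]
  have "v_closure D I \<subseteq> v_closure D (span_over D (*) (insert a A))"
    by (simp add: v_closure_def)
  moreover have "a \<in> span_over D (*) (insert a A)"
    using span_superset by blast
  then have "span_over D (*) (insert a A) \<noteq> {0}"
    using a(2) by (metis singletonD)
  moreover have "span_over D (*) (insert a A) \<subseteq> I"
    using A(3) a(1) assms(2) by (intro span_over_minimal) auto
  moreover have "finitely_generated D (span_over D (*) (insert a A))"
    using A(1) unfolding finitely_generated_def by blast
  ultimately show "v_closure D I \<subseteq> t_closure D I"
    unfolding t_closure_def by blast
qed

end

section \<open>The group of t-invertible t-ideals\<close>

locale subring_with_quotients = subring_on +
  assumes quotient: "\<exists>a\<in>D. \<exists>b\<in>D - {0}. x = a / b"
begin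

text \<open>A multiplier p/q from the field can be replaced by its numerator, because p x = q ((p/q)
  x).\<close>

lemma fractional_ideal_iff:
  "fractional_ideal D I \<longleftrightarrow> submodule_on I \<and> (\<exists>b\<in>ideal_inverse D I. b \<noteq> 0)"
proof -
  have "\<exists>a\<in>D - {0}. \<forall>x\<in>I. a * x \<in> D" if b: "b \<in> ideal_inverse D I" "b \<noteq> 0" for b
  proof -
    obtain p q where pq: "p \<in> D" "q \<in> D" "q \<noteq> 0" "b = p / q"
      using quotient[of b] by auto
    have "p * x \<in> D" if "x \<in> I" for x
    proof -
      have "q * (b * x) \<in> D"
        by (rule mult_in; use b(1) that pq(2) in \<open>auto simp: ideal_inverse_def\<close>)
      then show ?thesis
        using pq by simp
    qed
    then show ?thesis
      using pq b(2) by auto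
  qed
  then show ?thesis
    unfolding fractional_ideal_def submodule_iff by (auto simp: ideal_inverse_def)
qed

text \<open>For finitely v-invertible submodules with a nonzero element the t-closure and the
  v-closure agree, so the group can be handled through inverses alone.\<close>

lemma carrier_t_ideal_group_iff:
  "I \<in> carrier (t_ideal_group D) \<longleftrightarrow>
     v_closure D I = I \<and> (\<exists>a\<in>I. a \<noteq> 0) \<and> (\<exists>b\<in>ideal_inverse D I. b \<noteq> 0) \<and> finitely_v_invertible I"
    (is "_ \<longleftrightarrow> ?R")
proof
  assume "I \<in> carrier (t_ideal_group D)"
  then have I: "submodule_on I" "\<exists>b\<in>ideal_inverse D I. b \<noteq> 0" "I \<noteq> {0}" "t_closure D I = I"
      "finitely_v_invertible I"
    by (auto simp: t_ideal_group_def t_ideal_def fractional_ideal_iff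
        t_invertible_imp_finitely_v_invertible)
  then obtain a where "a \<in> I" "a \<noteq> 0"
    using submodule_onD(1) by blast
  then show ?R
    using I finitely_v_invertible_t_closure by auto
next
  assume R: ?R
  then have "submodule_on I"
    using submodule_on_inverse[of "ideal_inverse D I"] by (simp add: v_closure_def)
  then show "I \<in> carrier (t_ideal_group D)"
    using R finitely_v_invertible_t_closure finitely_v_invertible_imp_t_invertible
    by (auto simp: t_ideal_group_def t_ideal_def fractional_ideal_iff)
qed

lemma v_closure_products_carrier:
  assumes "I \<in> carrier (t_ideal_group D)" "J \<in> carrier (t_ideal_group D)"
  shows "v_closure D (products I J) \<in> carrier (t_ideal_group D)"
    and "I \<otimes>\<^bsub>t_ideal_group D\<^esub> J = v_closure D (products I J)"
proof -
  obtain a b where a: "a \<in> I" "a \<noteq> 0" and b: "b \<in> J" "b \<noteq> 0"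
    using assms by (auto simp: carrier_t_ideal_group_iff)
  obtain x y where x: "x \<in> ideal_inverse D I" "x \<noteq> 0" and y: "y \<in> ideal_inverse D J" "y \<noteq> 0"
    using assms by (auto simp: carrier_t_ideal_group_iff)
  have fin: "finitely_v_invertible (products I J)"
    using assms by (auto simp: carrier_t_ideal_group_iff intro: finitely_v_invertible_products)
  have ab: "a * b \<in> products I J" "a * b \<noteq> 0"
    using a b by (auto intro: productsI)
  have xy: "x * y \<in> ideal_inverse D (products I J)"
  proof -
    have "x * y * (i * j) \<in> D" if "i \<in> I" "j \<in> J" for i j
    proof -
      have "(x * i) * (y * j) \<in> D"
        by (rule mult_in; use x y that in \<open>auto simp: ideal_inverse_def\<close>)
      then show ?thesis
        by (simp add: mult_ac)
    qed
    then show ?thesis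
      by (auto simp: ideal_inverse_def products_def)
  qed
  have "\<exists>c\<in>v_closure D (products I J). c \<noteq> 0"
    using ab v_closure_superset by blast
  moreover have "\<exists>c\<in>ideal_inverse D (v_closure D (products I J)). c \<noteq> 0"
    using xy x(2) y(2) by (intro bexI[of _ "x * y"]) auto
  moreover have "finitely_v_invertible (v_closure D (products I J))"
    using finitely_v_invertible_mono[OF fin v_closure_superset] by simp
  ultimately show "v_closure D (products I J) \<in> carrier (t_ideal_group D)"
    by (simp add: carrier_t_ideal_group_iff)
  have "finitely_v_invertible (ideal_mult D I J)"
    using finitely_v_invertible_mono[OF fin products_subset_ideal_mult] by simp
  then have "t_closure D (ideal_mult D I J) = v_closure D (ideal_mult D I J)"
    using ab products_subset_ideal_mult
    by (intro finitely_v_invertible_t_closure submodule_on_ideal_mult) auto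
  then show "I \<otimes>\<^bsub>t_ideal_group D\<^esub> J = v_closure D (products I J)"
    by (simp add: t_ideal_group_def)
qed

lemma one_t_ideal_group [simp]: "\<one>\<^bsub>t_ideal_group D\<^esub> = D"
  by (simp add: t_ideal_group_def)

lemma principal_in_carrier:
  assumes "x \<noteq> 0"
  shows "principal_fractional D x \<in> carrier (t_ideal_group D)"
proof -
  have "finitely_v_invertible (principal_fractional D x)"
  proof (rule finitely_v_invertibleI)
    show "{x} \<subseteq> principal_fractional D x" "{inverse x} \<subseteq> ideal_inverse D (principal_fractional D x)"
      using assms mem_principal by (auto simp: ideal_inverse_principal)
    show "ideal_inverse D (products {x} {inverse x}) \<subseteq> D"
      using assms by (auto simp: ideal_inverse_def products_def)
  qed auto
  moreover have "\<exists>b\<in>ideal_inverse D (principal_fractional D x). b \<noteq> 0"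
    using assms mem_principal[of "inverse x"]
    by (auto simp: ideal_inverse_principal intro!: bexI[of _ "inverse x"])
  ultimately show ?thesis
    using assms mem_principal[of x] by (auto simp: carrier_t_ideal_group_iff v_closure_principal)
qed

text \<open>The finite witnesses \<open>A\<close> and \<open>B\<close> exchange roles, because the
  inverse of the inverse is \<open>I\<close> again.\<close>

lemma inverse_in_carrier:
  assumes "I \<in> carrier (t_ideal_group D)"
  shows "ideal_inverse D I \<in> carrier (t_ideal_group D)"
proof -
  have v: "ideal_inverse D (ideal_inverse D I) = I"
    using assms by (auto simp: carrier_t_ideal_group_iff v_closure_def)
  obtain A B where "finite A" "finite B" "A \<subseteq> I" "B \<subseteq> ideal_inverse D I"
      "ideal_inverse D (products A B) \<subseteq> D"
    using assms unfolding carrier_t_ideal_group_iff finitely_v_invertible_def by blast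
  then have "finitely_v_invertible (ideal_inverse D I)"
    by (intro finitely_v_invertibleI[of B A]) (auto simp: v products_commute)
  then show ?thesis
    using assms by (auto simp: carrier_t_ideal_group_iff v)
qed

lemma v_closure_products_inverse:
  assumes "finitely_v_invertible I"
  shows "v_closure D (products (ideal_inverse D I) I) = D"
proof -
  obtain A B where A: "A \<subseteq> I" "B \<subseteq> ideal_inverse D I" "ideal_inverse D (products A B) \<subseteq> D"
    using assms unfolding finitely_v_invertible_def by blast
  have "products A B \<subseteq> products (ideal_inverse D I) I"
    using products_mono[OF A(1,2)] by (simp add: products_commute)
  then have "ideal_inverse D (products (ideal_inverse D I) I) \<subseteq> D"
    using ideal_inverse_antimono A(3) by blast
  moreover have "D \<subseteq> ideal_inverse D (products (ideal_inverse D I) I)"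
    using ideal_inverse_antimono[OF products_inverse_subset[of I]] by (simp add: products_commute)
  ultimately show ?thesis
    by (simp add: v_closure_def)
qed

lemma comm_group_t_ideal_group: "comm_group (t_ideal_group D)"
proof (rule comm_groupI)
  let ?G = "t_ideal_group D"
  show "\<one>\<^bsub>?G\<^esub> \<in> carrier ?G"
    using principal_in_carrier[of 1] by simp
  show "x \<otimes>\<^bsub>?G\<^esub> y \<in> carrier ?G" if "x \<in> carrier ?G" "y \<in> carrier ?G" for x y
    using that by (simp add: v_closure_products_carrier)
  show "x \<otimes>\<^bsub>?G\<^esub> y = y \<otimes>\<^bsub>?G\<^esub> x" if "x \<in> carrier ?G" "y \<in> carrier ?G" for x y
    using that by (simp add: v_closure_products_carrier products_commute)
  show "x \<otimes>\<^bsub>?G\<^esub> y \<otimes>\<^bsub>?G\<^esub> z = x \<otimes>\<^bsub>?G\<^esub> (y \<otimes>\<^bsub>?G\<^esub> z)"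
    if "x \<in> carrier ?G" "y \<in> carrier ?G" "z \<in> carrier ?G" for x y z
    using that by (simp add: v_closure_products_carrier v_closure_products_v_closure products_assoc)
  show "\<exists>y\<in>carrier ?G. y \<otimes>\<^bsub>?G\<^esub> x = \<one>\<^bsub>?G\<^esub>" if "x \<in> carrier ?G" for x
    using that inverse_in_carrier[OF that]
    by (intro bexI[of _ "ideal_inverse D x"])
       (auto simp: v_closure_products_carrier v_closure_products_inverse carrier_t_ideal_group_iff[of x])
  show "\<one>\<^bsub>?G\<^esub> \<otimes>\<^bsub>?G\<^esub> x = x" if x: "x \<in> carrier ?G" for x
  proof -
    have vx: "v_closure D x = x"
      using x by (simp add: carrier_t_ideal_group_iff)
    then have "submodule_on x"
      using submodule_on_inverse[of "ideal_inverse D x"] by (simp add: v_closure_def)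
    then have "products D x = x"
      using productsI[OF one_in] by (fastforce simp: products_def submodule_onD(3))
    then show ?thesis
      using x principal_in_carrier[of 1] vx by (simp add: v_closure_products_carrier)
  qed
qed

lemma inv_t_ideal_group:
  assumes "I \<in> carrier (t_ideal_group D)"
  shows "inv\<^bsub>t_ideal_group D\<^esub> I = ideal_inverse D I"
proof -
  interpret comm_group "t_ideal_group D"
    by (rule comm_group_t_ideal_group)
  show ?thesis
    using assms inverse_in_carrier[OF assms]
    by (intro inv_equality)
       (auto simp: v_closure_products_carrier v_closure_products_inverse carrier_t_ideal_group_iff[of I])
qed

lemma normal_principal_group: "principal_group D \<lhd> t_ideal_group D"
proof -
  interpret comm_group "t_ideal_group D"
    by (rule comm_group_t_ideal_group)
  have "subgroup (principal_group D) (t_ideal_group D)"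
  proof (rule subgroupI)
    show "principal_group D \<subseteq> carrier (t_ideal_group D)"
      using principal_in_carrier by (auto simp: principal_group_def)
    show "principal_group D \<noteq> {}"
      by (auto simp: principal_group_def intro: exI[of _ 1])
  next
    fix I assume "I \<in> principal_group D"
    then obtain x where "x \<noteq> 0" "I = principal_fractional D x"
      by (auto simp: principal_group_def)
    then show "inv\<^bsub>t_ideal_group D\<^esub> I \<in> principal_group D"
      using principal_in_carrier[of x]
      by (auto simp: inv_t_ideal_group ideal_inverse_principal principal_group_def intro!: exI[of _ "inverse x"])
  next
    fix I J assume "I \<in> principal_group D" "J \<in> principal_group D"
    then obtain x y where "x \<noteq> 0" "I = principal_fractional D x" "y \<noteq> 0" "J = principal_fractional D y"
      by (auto simp: principal_group_def)
    then show "I \<otimes>\<^bsub>t_ideal_group D\<^esub> J \<in> principal_group D"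
      using principal_in_carrier[of x] principal_in_carrier[of y]
      by (auto simp: v_closure_products_carrier products_principal v_closure_principal
          principal_group_def intro!: exI[of _ "x * y"])
  qed
  then show ?thesis
    by (simp add: normal_iff_subgroup)
qed

section \<open>Classes modulo principal ideals\<close>

lemma group_t_class_group: "group (t_class_group D)"
  unfolding t_class_group_def by (rule normal.factorgroup_is_group[OF normal_principal_group])

lemma t_class_hom: "t_class D \<in> hom (t_ideal_group D) (t_class_group D)"
proof -
  have "t_class D = (\<lambda>I. principal_group D #>\<^bsub>t_ideal_group D\<^esub> I)"
    by (simp add: t_class_def fun_eq_iff)
  then show ?thesis
    unfolding t_class_group_def using normal.r_coset_hom_Mod[OF normal_principal_group] by simp
qed

lemma t_class_ideal_inverse:
  assumes "I \<in> carrier (t_ideal_group D)"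
  shows "t_class D (ideal_inverse D I) = inv\<^bsub>t_class_group D\<^esub> (t_class D I)"
proof -
  interpret group_hom "t_ideal_group D" "t_class_group D" "t_class D"
    using comm_group_t_ideal_group group_t_class_group t_class_hom
    by (intro group_hom.intro group_hom_axioms.intro) (auto simp: comm_group_def)
  show ?thesis
    using hom_inv[OF assms] inv_t_ideal_group[OF assms] by simp
qed

lemma t_class_eq_one_iff:
  assumes "I \<in> carrier (t_ideal_group D)"
  shows "t_class D I = \<one>\<^bsub>t_class_group D\<^esub> \<longleftrightarrow> is_principal D I"
proof -
  interpret comm_group "t_ideal_group D"
    by (rule comm_group_t_ideal_group)
  have sub: "subgroup (principal_group D) (t_ideal_group D)"
    using normal_principal_group normal_imp_subgroup by blast
  have "t_class D I = \<one>\<^bsub>t_class_group D\<^esub> \<longleftrightarrow> principal_group D #>\<^bsub>t_ideal_group D\<^esub> I = principal_group D"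
    by (simp add: t_class_def t_class_group_def)
  also have "\<dots> \<longleftrightarrow> I \<in> principal_group D"
    using coset_join1[OF _ assms sub] coset_join2[OF assms sub] by blast
  also have "\<dots> \<longleftrightarrow> is_principal D I"
  proof -
    \<comment> \<open>\<open>is_principal\<close> admits the generator 0 and
      \<open>principal_group\<close> does not; the difference vanishes because elements of the
      carrier are nonzero.\<close>
    have "x \<noteq> 0" if "I = principal_fractional D x" for x
      using assms that by (auto simp: carrier_t_ideal_group_iff principal_fractional_def)
    then show ?thesis
      by (auto simp: principal_group_def is_principal_def)
  qed
  finally show ?thesis .
qed

text \<open>A subgroup contains the inverses of its generators, which gives one inclusion for any
  family in the carrier. Applied to the family of inverses it gives the other one.\<close>

lemma generate_t_class_ideal_inverse:
  assumes "\<And>n. I n \<in> carrier (t_ideal_group D)"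
  shows "generate (t_class_group D) (range (\<lambda>n. t_class D (ideal_inverse D (I n)))) =
    generate (t_class_group D) (range (\<lambda>n. t_class D (I n)))"
proof -
  interpret C: group "t_class_group D"
    by (rule group_t_class_group)
  have sub: "generate (t_class_group D) (range (\<lambda>n. t_class D (ideal_inverse D (J n)))) \<subseteq>
      generate (t_class_group D) (range (\<lambda>n. t_class D (J n)))"
    if J: "\<And>n. J n \<in> carrier (t_ideal_group D)" for J :: "'b \<Rightarrow> 'a set"
  proof (rule C.generate_subgroup_incl)
    show "range (\<lambda>n. t_class D (ideal_inverse D (J n))) \<subseteq>
        generate (t_class_group D) (range (\<lambda>n. t_class D (J n)))"
      using t_class_ideal_inverse[OF J] by (auto intro: generate.inv)
    show "subgroup (generate (t_class_group D) (range (\<lambda>n. t_class D (J n)))) (t_class_group D)"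
      using J t_class_hom by (intro C.generate_is_subgroup) (auto simp: hom_def)
  qed
  have "ideal_inverse D (ideal_inverse D (I n)) = I n" for n
    using assms[of n] by (simp add: carrier_t_ideal_group_iff v_closure_def)
  then show ?thesis
    using sub[of I, OF assms] sub[of "\<lambda>n. ideal_inverse D (I n)", OF inverse_in_carrier[OF assms]]
    by auto
qed

lemma generate_t_class_trivial_iff:
  assumes "\<And>n. I n \<in> carrier (t_ideal_group D)"
  shows "generate (t_class_group D) (range (\<lambda>n. t_class D (I n))) = {\<one>\<^bsub>t_class_group D\<^esub>} \<longleftrightarrow>
    (\<forall>n. is_principal D (I n))"
proof -
  interpret C: group "t_class_group D"
    by (rule group_t_class_group)
  let ?X = "range (\<lambda>n. t_class D (I n))"
  have "generate (t_class_group D) ?X = {\<one>\<^bsub>t_class_group D\<^esub>} \<longleftrightarrow> ?X \<subseteq> {\<one>\<^bsub>t_class_group D\<^esub>}"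
  proof
    show "?X \<subseteq> {\<one>\<^bsub>t_class_group D\<^esub>}" if "generate (t_class_group D) ?X = {\<one>\<^bsub>t_class_group D\<^esub>}"
      using generate.incl[of _ ?X "t_class_group D"] unfolding that by (rule subsetI)
    assume "?X \<subseteq> {\<one>\<^bsub>t_class_group D\<^esub>}"
    then have "generate (t_class_group D) ?X \<subseteq> {\<one>\<^bsub>t_class_group D\<^esub>}"
      by (rule C.generate_subgroup_incl) (rule C.triv_subgroup)
    then show "generate (t_class_group D) ?X = {\<one>\<^bsub>t_class_group D\<^esub>}"
      using generate.one[of "t_class_group D" ?X] by (intro equalityI) simp_all
  qed
  also have "\<dots> \<longleftrightarrow> (\<forall>n. is_principal D (I n))"
    using t_class_eq_one_iff[OF assms] by auto
  finally show ?thesis .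
qed

lemma char_ideal_in_carrier:
  assumes "t_invertible D (char_ideal D n)"
  shows "char_ideal D n \<in> carrier (t_ideal_group D)"
proof -
  let ?I = "char_ideal D n"
  have inv: "1 \<in> ideal_mult D ?I (ideal_inverse D ?I)"
    by (rule char_ideal_invertible[OF assms])
  \<comment> \<open>If the inverse were zero, so would be the product ideal, which contains
    1.\<close>
  have "\<exists>b\<in>ideal_inverse D ?I. b \<noteq> 0"
  proof (rule ccontr)
    assume "\<not> ?thesis"
    then have "products ?I (ideal_inverse D ?I) \<subseteq> {0}"
      by (auto simp: products_def)
    then have "ideal_mult D ?I (ideal_inverse D ?I) \<subseteq> {0}"
      unfolding ideal_mult_eq by (intro span_over_minimal) (auto simp: submodule_on_def)
    then show False
      using inv by auto
  qed
  moreover have "\<exists>a\<in>?I. a \<noteq> 0"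
    using one_mem_char_ideal by (intro bexI[of _ 1]) auto
  ultimately show ?thesis
    using invertible_imp_divisorial[OF submodule_on_char_ideal inv]
      t_invertible_imp_finitely_v_invertible[OF assms]
    by (simp add: carrier_t_ideal_group_iff)
qed

end

subsection \<open>Regular bases\<close>

text \<open>Polynomials of degree below \<open>m\<close> do not reach X^m, those above
  \<open>m\<close> have coefficient 0 in the sum, and \<open>b0\<close> is the only one of degree
  \<open>m\<close>.\<close>

lemma coeff_sum_smult:
  assumes "finite F" "inj_on degree F" "\<And>b. b \<in> F \<Longrightarrow> degree b > m \<Longrightarrow> c b = 0"
    and "b0 \<in> F" "degree b0 = m"
  shows "coeff (\<Sum>b\<in>F. Polynomial.smult (c b) b) m = c b0 * coeff b0 m"
proof -
  have zero: "c b * coeff b m = 0" if "b \<in> F - {b0}" for b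
  proof -
    have "degree b \<noteq> m"
      using that assms(2,4,5) by (auto dest: inj_onD)
    then show ?thesis
      using that assms(3)[of b] by (cases "degree b" m rule: linorder_cases) (auto simp: coeff_eq_0)
  qed
  have "coeff (\<Sum>b\<in>F. Polynomial.smult (c b) b) m = (\<Sum>b\<in>F. c b * coeff b m)"
    by (simp add: coeff_sum)
  also have "\<dots> = c b0 * coeff b0 m + (\<Sum>b\<in>F - {b0}. c b * coeff b m)"
    using assms(1,4) by (rule sum.remove)
  also have "(\<Sum>b\<in>F - {b0}. c b * coeff b m) = 0"
    using zero by (intro sum.neutral) blast
  finally show ?thesis
    by simp
qed

text \<open>Among the terms of degree at least \<open>k\<close> with nonzero coefficient, the
  leading term of one of maximal degree cannot cancel. The case k = 0 is linear independence; k =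
  n+1 bounds the degrees occurring in a combination of degree at most n.\<close>

lemma sum_smult_degree_vanish:
  fixes F :: "'a::idom poly set"
  assumes "finite F" "inj_on degree F" "0 \<notin> F"
    and van: "\<And>m. m \<ge> k \<Longrightarrow> coeff (\<Sum>b\<in>F. Polynomial.smult (c b) b) m = 0"
    and "b \<in> F" "degree b \<ge> k"
  shows "c b = 0"
proof (rule ccontr)
  assume "c b \<noteq> 0"
  define S where "S = {b \<in> F. c b \<noteq> 0 \<and> degree b \<ge> k}"
  have S: "finite (degree ` S)" "degree ` S \<noteq> {}"
    using assms \<open>c b \<noteq> 0\<close> by (auto simp: S_def)
  from Max_in[OF S] obtain b0 where b0: "b0 \<in> S" "degree b0 = Max (degree ` S)"
    by auto
  have "c b' = 0" if "b' \<in> F" "degree b' > degree b0" for b'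
  proof (rule ccontr)
    assume "c b' \<noteq> 0"
    then have "b' \<in> S"
      using that b0(1) by (auto simp: S_def)
    then show False
      using that(2) Max_ge[OF S(1), of "degree b'"] b0(2) by auto
  qed
  then have "coeff (\<Sum>b\<in>F. Polynomial.smult (c b) b) (degree b0) = c b0 * lead_coeff b0"
    using b0(1) by (intro coeff_sum_smult assms) (auto simp: S_def)
  then show False
    using van[of "degree b0"] b0(1) assms(3) by (auto simp: S_def)
qed

context subring_on
begin

text \<open>The generator is the leading coefficient of the basis element of degree
  \<open>n\<close>: a polynomial of degree at most \<open>n\<close> involves no basis element of
  higher degree, and lower ones do not contribute to X^n.\<close>

lemma is_principal_char_ideal_of_regular_basis:
  assumes "has_regular_basis D"
  shows "is_principal D (char_ideal D n)"
proof -
  obtain B where ind: "independent_over D Polynomial.smult B"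
      and span: "span_over D Polynomial.smult B = Int_poly D"
      and uniq: "\<And>n. \<exists>!f. f \<in> B \<and> degree f = n"
    using assms unfolding has_regular_basis_def module_basis_def by blast
  have inj: "inj_on degree F" if "F \<subseteq> B" for F
    using uniq that unfolding inj_on_def by (metis subsetD)
  \<comment> \<open>The zero polynomial has degree 0 by convention, so only independence keeps it
    out of the basis.\<close>
  have "0 \<notin> B"
  proof
    assume "0 \<in> B"
    then have "(1::'a) = 0"
      using ind[unfolded independent_over_def, rule_format, of "{0}" "\<lambda>_. 1" 0] by simp
    then show False
      by simp
  qed
  obtain g where g: "g \<in> B" "degree g = n"
    using uniq by blast
  have "Polynomial.smult 1 g \<in> span_over D Polynomial.smult B"
    using g(1) by (intro span_over_scaled_base) auto
  then have "g \<in> Int_poly_deg D n"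
    using g(2) by (simp add: span Int_poly_deg_def)
  then have g_n: "coeff g n \<in> char_ideal D n"
    by (rule coeff_mem_char_ideal)
  have "char_ideal D n \<subseteq> principal_fractional D (coeff g n)"
  proof
    fix x assume "x \<in> char_ideal D n"
    then obtain f where f: "f \<in> span_over D Polynomial.smult B" "degree f \<le> n" "x = coeff f n"
      by (auto simp: char_ideal_def Int_poly_deg_def span)
    obtain F c where F: "finite F" "F \<subseteq> B" "c ` F \<subseteq> D" "f = (\<Sum>b\<in>F. Polynomial.smult (c b) b)"
      using f(1) unfolding span_over_def by blast
    have "0 \<notin> F"
      using F(2) \<open>0 \<notin> B\<close> by blast
    moreover have "coeff (\<Sum>b\<in>F. Polynomial.smult (c b) b) m = 0" if "m \<ge> Suc n" for m
      using that f(2) by (intro coeff_eq_0) (simp add: F(4)[symmetric])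
    ultimately have van: "c b = 0" if "b \<in> F" "degree b > n" for b
      using that F(1) inj[OF F(2)] sum_smult_degree_vanish[of F "Suc n" c b] by simp
    show "x \<in> principal_fractional D (coeff g n)"
    proof (cases "g \<in> F")
      case True
      then have "x = coeff g n * c g"
        unfolding f(3) F(4) using coeff_sum_smult[OF F(1) inj[OF F(2)] van True g(2)]
        by (simp add: mult.commute)
      then show ?thesis
        using True F(3) by (auto simp: principal_fractional_def)
    next
      case False
      have "c b * coeff b n = 0" if "b \<in> F" for b
      proof -
        have "degree b \<noteq> n"
          using False that F(2) g uniq by blast
        then show ?thesis
          using van[OF that] by (cases "degree b" n rule: linorder_cases) (auto simp: coeff_eq_0)
      qed
      then have "x = 0"
        unfolding f(3) F(4) coeff_sum coeff_smult by (intro sum.neutral) blast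
      then show ?thesis
        using submodule_onD(1)[OF submodule_on_principal] by simp
    qed
  qed
  moreover have "principal_fractional D (coeff g n) \<subseteq> char_ideal D n"
    using submodule_onD(3)[OF submodule_on_char_ideal _ g_n]
    by (auto simp: principal_fractional_def mult.commute)
  ultimately show ?thesis
    unfolding is_principal_def by blast
qed

text \<open>Polynomials \<open>g n\<close> whose leading coefficients generate the characteristic
  ideals form the basis. Successive subtraction of multiples of them reduces any integer-valued
  polynomial to 0.\<close>

lemma regular_basis_of_principal_char_ideals:
  assumes "\<And>n. is_principal D (char_ideal D n)"
  shows "has_regular_basis D"
proof -
  obtain a where a: "\<And>n. char_ideal D n = principal_fractional D (a n)"
    using assms unfolding is_principal_def by metis
  have "a n \<in> char_ideal D n" for n
    unfolding a by (auto simp: principal_fractional_def intro!: exI[of _ 1])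
  then have "\<exists>f. f \<in> Int_poly_deg D n \<and> coeff f n = a n" for n
    by (force simp: char_ideal_def)
  then obtain g where g: "\<And>n. g n \<in> Int_poly_deg D n" "\<And>n. coeff (g n) n = a n"
    by metis
  \<comment> \<open>The ideal contains 1, so its generator is nonzero and \<open>g n\<close> has
    degree exactly \<open>n\<close>.\<close>
  have a0: "a n \<noteq> 0" for n
    using one_mem_char_ideal[of n] by (auto simp: a principal_fractional_def)
  have deg: "degree (g n) = n" for n
    using g[of n] a0[of n] le_degree[of "g n" n] by (auto simp: mem_Int_poly_deg)
  let ?B = "range g"
  have inj: "inj_on degree F" if "F \<subseteq> ?B" for F
  proof (rule inj_onI)
    fix p q assume "p \<in> F" "q \<in> F" "degree p = degree q"
    then show "p = q"
      using that deg by (metis imageE subsetD)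
  qed
  have "0 \<notin> ?B"
    using g(2) a0 by (metis coeff_0 imageE)
  have "independent_over D Polynomial.smult ?B"
    unfolding independent_over_def
  proof (intro allI impI ballI, elim conjE)
    fix F c b
    assume F: "finite F" "F \<subseteq> ?B" "(\<Sum>b\<in>F. Polynomial.smult (c b) b) = 0" and b: "b \<in> F"
    show "c b = 0"
      using F(1) inj[OF F(2)] _ _ b
    proof (rule sum_smult_degree_vanish[where k = 0])
      show "0 \<notin> F"
        using F(2) \<open>0 \<notin> ?B\<close> by blast
      show "coeff (\<Sum>b\<in>F. Polynomial.smult (c b) b) m = 0" for m
        by (simp add: F(3))
    qed simp
  qed
  moreover have "span_over D Polynomial.smult ?B = Int_poly D"
  proof
    show "span_over D Polynomial.smult ?B \<subseteq> Int_poly D"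
    proof
      fix f assume "f \<in> span_over D Polynomial.smult ?B"
      then obtain F c where F: "F \<subseteq> ?B" "c ` F \<subseteq> D" "f = (\<Sum>b\<in>F. Polynomial.smult (c b) b)"
        unfolding span_over_def by blast
      have "poly f x \<in> D" if "x \<in> D" for x
      proof -
        have "c b * poly b x \<in> D" if "b \<in> F" for b
          using that F(1,2) g(1) \<open>x \<in> D\<close>
          by (intro mult_in) (auto simp: mem_Int_poly_deg dest!: subsetD)
        then show ?thesis
          unfolding F(3) poly_sum poly_smult by (rule sum_in)
      qed
      then show "f \<in> Int_poly D"
        by (simp add: Int_poly_def)
    qed
    have reduce: "\<exists>d\<in>D. f - Polynomial.smult d (g n) \<in> Int_poly_deg D n \<and>
        coeff (f - Polynomial.smult d (g n)) n = 0" if f: "f \<in> Int_poly_deg D n" for f n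
    proof -
      obtain d where d: "d \<in> D" "coeff f n = a n * d"
        using coeff_mem_char_ideal[OF f] by (auto simp: a principal_fractional_def)
      have "f + Polynomial.smult (- d) (g n) \<in> Int_poly_deg D n"
        using d(1) f g(1) by (intro Int_poly_deg_add Int_poly_deg_smult uminus_in)
      then show ?thesis
        using d by (intro bexI[of _ d]) (auto simp: g(2))
    qed
    have span_step: "f \<in> span_over D Polynomial.smult ?B"
      if "f - Polynomial.smult d (g n) \<in> span_over D Polynomial.smult ?B" "d \<in> D" for f d n
    proof -
      have "(f - Polynomial.smult d (g n)) + Polynomial.smult d (g n) \<in> span_over D Polynomial.smult ?B"
        using that by (intro span_over_add span_over_scaled_base) (auto simp: add_in smult_add_left)
      then show ?thesis
        by simp
    qed
    have "f \<in> span_over D Polynomial.smult ?B" if "f \<in> Int_poly_deg D n" for f n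
      using that
    proof (induction n arbitrary: f)
      case 0
      then obtain d where d: "d \<in> D" "f - Polynomial.smult d (g 0) \<in> Int_poly_deg D 0"
          "coeff (f - Polynomial.smult d (g 0)) 0 = 0"
        using reduce by blast
      have "f - Polynomial.smult d (g 0) = 0"
        using d(2,3) leading_coeff_0_iff[of "f - Polynomial.smult d (g 0)"]
        by (simp add: mem_Int_poly_deg)
      then show ?case
        using d(1) span_step[of f d 0] span_over_zero by metis
    next
      case (Suc n)
      then obtain d where d: "d \<in> D" "f - Polynomial.smult d (g (Suc n)) \<in> Int_poly_deg D (Suc n)"
          "coeff (f - Polynomial.smult d (g (Suc n))) (Suc n) = 0"
        using reduce by blast
      then show ?case
        using span_step[OF Suc.IH[OF Int_poly_deg_drop]] by blast
    qed
    then show "Int_poly D \<subseteq> span_over D Polynomial.smult ?B"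
      by (auto simp: Int_poly_deg_def)
  qed
  moreover have "\<exists>!f. f \<in> ?B \<and> degree f = n" for n
    using deg by (intro ex1I[of _ "g n"]) auto
  ultimately show ?thesis
    unfolding has_regular_basis_def module_basis_def by blast
qed

theorem has_regular_basis_iff: "has_regular_basis D \<longleftrightarrow> (\<forall>n. is_principal D (char_ideal D n))"
  using is_principal_char_ideal_of_regular_basis regular_basis_of_principal_char_ideals by blast

subsection \<open>Localization\<close>

lemma primeideal_complement:
  assumes "primeideal P (ring_on D)"
  shows "P \<subseteq> D" "submodule_on P" "multiplicative_subset D (D - P)"
proof -
  interpret primeideal P "ring_on D"
    by (rule assms)
  show "P \<subseteq> D"
    using Icarr by auto
  show sub: "submodule_on P"
    using additive_subgroup.zero_closed[OF is_additive_subgroup]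
      additive_subgroup.a_closed[OF is_additive_subgroup] I_l_closed
    by (intro submodule_onI) auto
  have "1 \<notin> P"
    using I_notcarr one_imp_carrier by auto
  moreover have "x * y \<notin> P" if "x \<in> D - P" "y \<in> D - P" for x y
    using that I_prime[of x y] by auto
  ultimately show "multiplicative_subset D (D - P)"
    using mult_in submodule_onD(1)[OF sub]
    by (auto simp: multiplicative_subset_def intro!: submonoid.intro)
qed

lemma subring_on_localization:
  assumes "multiplicative_subset D S"
  shows "subring_on (localization S (*) D)"
proof -
  interpret submonoid S "ring_on D"
    using assms by (simp add: multiplicative_subset_def)
  have S: "0 \<notin> S" "\<And>s. s \<in> S \<Longrightarrow> s \<in> D" "\<And>s t. s \<in> S \<Longrightarrow> t \<in> S \<Longrightarrow> s * t \<in> S"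
    using assms subset m_closed by (auto simp: multiplicative_subset_def)
  have D: "d \<in> localization S (*) D" if "d \<in> D" for d
  proof -
    have "1 \<in> S" "d = inverse 1 * d"
      using one_closed by simp_all
    then show ?thesis
      unfolding localization_def using that by blast
  qed
  show ?thesis
  proof
    fix x y assume "x \<in> localization S (*) D" "y \<in> localization S (*) D"
    then obtain s d t e where st: "s \<in> S" "d \<in> D" "t \<in> S" "e \<in> D"
        "x = inverse s * d" "y = inverse t * e"
      by (auto simp: localization_def)
    then have nz: "s \<noteq> 0" "t \<noteq> 0"
      using S(1) by auto
    have "x + y = inverse (s * t) * (t * d + s * e)"
      using nz by (simp add: st field_simps)
    then show "x + y \<in> localization S (*) D"
      unfolding localization_def using st S by (blast intro: ring_in)
    have "x * y = inverse (s * t) * (d * e)"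
      using nz by (simp add: st field_simps)
    then show "x * y \<in> localization S (*) D"
      unfolding localization_def using st S by (blast intro: ring_in)
  next
    fix x assume "x \<in> localization S (*) D"
    then obtain s d where st: "s \<in> S" "d \<in> D" "x = inverse s * d"
      by (auto simp: localization_def)
    then have "- x = inverse s * (- d)"
      by simp
    then show "- x \<in> localization S (*) D"
      unfolding localization_def using st by (blast intro: uminus_in)
  qed (auto intro: D)
qed

lemma is_principal_char_ideal_localization:
  assumes inv: "1 \<in> ideal_mult D (char_ideal D n) (ideal_inverse D (char_ideal D n))"
    and P: "primeideal P (ring_on D)"
    and Int: "localization (D - P) Polynomial.smult (Int_poly D) = Int_poly (localization (D - P) (*) D)"
  shows "is_principal (localization (D - P) (*) D) (char_ideal (localization (D - P) (*) D) n)"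
proof -
  let ?I = "char_ideal D n" and ?S = "D - P"
  define R where "R = localization ?S (*) D"
  note P' = primeideal_complement[OF P]
  interpret R: subring_on R
    unfolding R_def by (rule subring_on_localization[OF P'(3)])
  interpret S: submonoid ?S "ring_on D"
    using P'(3) by (simp add: multiplicative_subset_def)
  have one_S: "1 \<in> ?S" and mult_S: "\<And>s t. s \<in> ?S \<Longrightarrow> t \<in> ?S \<Longrightarrow> s * t \<in> ?S" and "0 \<notin> ?S"
    using S.one_closed S.m_closed P'(3) by (auto simp: multiplicative_subset_def)
  \<comment> \<open>Otherwise the whole product ideal, and with it 1, would lie in
    \<open>P\<close>.\<close>
  have "\<not> products ?I (ideal_inverse D ?I) \<subseteq> P"
  proof
    assume "products ?I (ideal_inverse D ?I) \<subseteq> P"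
    then have "ideal_mult D ?I (ideal_inverse D ?I) \<subseteq> P"
      unfolding ideal_mult_eq by (rule span_over_minimal[OF P'(2)])
    then show False
      using inv one_S by blast
  qed
  then obtain a x where ax: "a \<in> ?I" "x \<in> ideal_inverse D ?I" "a * x \<in> ?S"
    using products_inverse_subset[of ?I] by (fastforce simp: products_def)
  then have "a * x \<noteq> 0"
    using \<open>0 \<notin> ?S\<close> by metis
  have "char_ideal R n = principal_fractional R a"
  proof
    show "char_ideal R n \<subseteq> principal_fractional R a"
    proof
      fix y assume "y \<in> char_ideal R n"
      then obtain f where f: "f \<in> Int_poly R" "degree f \<le> n" "y = coeff f n"
        by (auto simp: char_ideal_def Int_poly_deg_def)
      then obtain s h where h: "s \<in> ?S" "h \<in> Int_poly D" "f = Polynomial.smult (inverse s) h"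
        unfolding R_def Int[symmetric] by (auto simp: localization_def)
      have "s \<noteq> 0"
        using h(1) \<open>0 \<notin> ?S\<close> by metis
      then have "h \<in> Int_poly_deg D n"
        using f(2) h by (simp add: Int_poly_deg_def)
      then have "x * coeff h n \<in> D"
        using ax(2) coeff_mem_char_ideal by (auto simp: ideal_inverse_def)
      \<comment> \<open>Here \<open>a\<close> is cancelled by means of \<open>x\<close>: coefficient
        h_n over s equals a times x h_n / (s a x), where x h_n is in \<open>D\<close> and s a x is
        outside \<open>P\<close>.\<close>
      then have "inverse (s * (a * x)) * (x * coeff h n) \<in> R"
        unfolding R_def localization_def using mult_S[OF h(1) ax(3)] by blast
      moreover have "y = a * (inverse (s * (a * x)) * (x * coeff h n))"
        using \<open>s \<noteq> 0\<close> \<open>a * x \<noteq> 0\<close> by (simp add: f(3) h(3) field_simps)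
      ultimately show "y \<in> principal_fractional R a"
        unfolding principal_fractional_def by blast
    qed
    obtain h where h: "h \<in> Int_poly D" "degree h \<le> n" "a = coeff h n"
      using ax(1) by (auto simp: char_ideal_def Int_poly_deg_def)
    have "Polynomial.smult (inverse 1) h \<in> Int_poly R"
      unfolding R_def Int[symmetric]
      unfolding localization_def using one_S h(1) by blast
    then have "a \<in> char_ideal R n"
      using h(2,3) by (auto simp: char_ideal_def Int_poly_deg_def)
    then show "principal_fractional R a \<subseteq> char_ideal R n"
      using R.submodule_onD(3)[OF R.submodule_on_char_ideal]
      by (auto simp: principal_fractional_def mult.commute)
  qed
  then show ?thesis
    unfolding R_def is_principal_def by blast
qed

end

section \<open>From the library's notion of domain to the theorem\<close>

lemma domain_with_quotient_field_imp_subring: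
  assumes "domain_with_quotient_field D"
  shows "subring_with_quotients D"
proof -
  interpret domain "ring_on D"
    using assms by (simp add: domain_with_quotient_field_def)
  show ?thesis
  proof
    fix x assume "x \<in> D"
    then obtain y where "y \<in> D" "x + y = 0"
      using a_inv_closed[of x] r_neg[of x] by auto
    then show "- x \<in> D"
      by (metis add.inverse_unique)
  next
    show "\<exists>a\<in>D. \<exists>b\<in>D - {0}. x = a / b" for x
      using assms by (simp add: domain_with_quotient_field_def)
  qed (use a_closed m_closed zero_closed one_closed in auto)
qed

text \<open>The factorial ideals are also placed in the carrier of the group, so that the classes
  said to generate \<open>POG\<close> are genuine elements of the class group. The four equivalent
  conditions appear as three equivalences with the existence of a regular basis.\<close>

theorem theorem3p6:
  fixes D :: "'a::field set"
  assumes "domain_with_quotient_field D"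
    and "\<forall>n. t_invertible D (char_ideal D n)"
  shows "(\<forall>n. \<forall>f\<in>Int_poly_deg D n. \<forall>i. coeff f i \<in> char_ideal D n)
    \<and> (\<forall>n. factorial_ideal D n = poly_conductor D (Int_poly_deg D n))
    \<and> (\<forall>n. char_ideal D n = ideal_inverse D (factorial_ideal D n))
    \<and> (\<forall>n. factorial_ideal D n \<in> carrier (t_ideal_group D))
    \<and> POG D = generate (t_class_group D) (range (\<lambda>n. t_class D (factorial_ideal D n)))
    \<and> (has_regular_basis D \<longleftrightarrow> (\<forall>n. is_principal D (char_ideal D n)))
    \<and> (has_regular_basis D \<longleftrightarrow> (\<forall>n. is_principal D (factorial_ideal D n)))
    \<and> (has_regular_basis D \<longleftrightarrow> POG D = {\<one>\<^bsub>t_class_group D\<^esub>})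
    \<and> (polynomially_L_regular D \<longrightarrow>
        (\<forall>P. primeideal P (ring_on D) \<longrightarrow> has_regular_basis (localization (D - P) (*) D))
        \<and> locally_free D Polynomial.smult (Int_poly D))"
proof -
  interpret subring_with_quotients D
    using assms(1) by (rule domain_with_quotient_field_imp_subring)
  have inv: "1 \<in> ideal_mult D (char_ideal D n) (ideal_inverse D (char_ideal D n))" for n
    using assms(2) char_ideal_invertible by blast
  have coeffs: "coeff f i \<in> char_ideal D n" if "f \<in> Int_poly_deg D n" for n f i
    using inv that by (rule coeff_mem_char_ideal_of_invertible)
  have car: "char_ideal D n \<in> carrier (t_ideal_group D)" for n
    using assms(2) char_ideal_in_carrier by blast
  have conductor: "factorial_ideal D n = poly_conductor D (Int_poly_deg D n)" for n
  proof
    show "factorial_ideal D n \<subseteq> poly_conductor D (Int_poly_deg D n)"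
    proof
      fix x assume x: "x \<in> factorial_ideal D n"
      \<comment> \<open>The conductor consists of elements of \<open>D\<close>; the factorial ideal
        lies in \<open>D\<close> because 1 is in the characteristic ideal.\<close>
      then have "x * 1 \<in> D"
        using one_mem_char_ideal unfolding factorial_ideal_def ideal_inverse_def by blast
      then show "x \<in> poly_conductor D (Int_poly_deg D n)"
        using x coeffs by (auto simp: poly_conductor_def polys_over_def factorial_ideal_def ideal_inverse_def)
    qed
    show "poly_conductor D (Int_poly_deg D n) \<subseteq> factorial_ideal D n"
      by (auto simp: poly_conductor_def polys_over_def factorial_ideal_def ideal_inverse_def char_ideal_def)
  qed
  have char_eq: "char_ideal D n = ideal_inverse D (factorial_ideal D n)" for n
    using car[of n] by (simp add: carrier_t_ideal_group_iff factorial_ideal_def v_closure_def)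
  have fact_car: "factorial_ideal D n \<in> carrier (t_ideal_group D)" for n
    unfolding factorial_ideal_def by (rule inverse_in_carrier[OF car])
  have POG: "POG D = generate (t_class_group D) (range (\<lambda>n. t_class D (factorial_ideal D n)))"
    unfolding POG_def factorial_ideal_def by (rule generate_t_class_ideal_inverse[OF car, symmetric])
  have principal: "is_principal D (factorial_ideal D n) \<longleftrightarrow> is_principal D (char_ideal D n)" for n
    unfolding factorial_ideal_def using car[of n]
    by (intro is_principal_ideal_inverse_iff) (simp_all add: carrier_t_ideal_group_iff)
  have trivial: "POG D = {\<one>\<^bsub>t_class_group D\<^esub>} \<longleftrightarrow> (\<forall>n. is_principal D (char_ideal D n))"
    unfolding POG_def by (rule generate_t_class_trivial_iff[OF car])
  have basis_factorial: "has_regular_basis D \<longleftrightarrow> (\<forall>n. is_principal D (factorial_ideal D n))"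
    and basis_POG: "has_regular_basis D \<longleftrightarrow> POG D = {\<one>\<^bsub>t_class_group D\<^esub>}"
    by (simp_all only: principal trivial has_regular_basis_iff)
  have local_basis: "has_regular_basis (localization (D - P) (*) D)"
    and local_Int: "localization (D - P) Polynomial.smult (Int_poly D) = Int_poly (localization (D - P) (*) D)"
    if L: "polynomially_L_regular D" and P: "primeideal P (ring_on D)" for P
  proof -
    note S = primeideal_complement(3)[OF P]
    show Int: "localization (D - P) Polynomial.smult (Int_poly D) = Int_poly (localization (D - P) (*) D)"
      using L S by (simp add: polynomially_L_regular_def)
    show "has_regular_basis (localization (D - P) (*) D)"
      \<comment> \<open>The criterion for regular bases is applied with the localization as base
        ring.\<close>
      using subring_on.has_regular_basis_iff[OF subring_on_localization[OF S]]
        is_principal_char_ideal_localization[OF inv P Int] by blast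
  qed
  have free: "locally_free D Polynomial.smult (Int_poly D)" if L: "polynomially_L_regular D"
    unfolding locally_free_def
  proof (intro allI impI)
    fix P assume P: "primeideal P (ring_on D)"
    show "free_module (localization (D - P) (*) D) Polynomial.smult
        (localization (D - P) Polynomial.smult (Int_poly D))"
      \<comment> \<open>By L-regularity the localized module is the ring of integer-valued
        polynomials over the local ring, so a regular basis of the latter is a basis of the
        former.\<close>
      using local_basis[OF L P] unfolding local_Int[OF L P] free_module_def has_regular_basis_def
      by blast
  qed
  show ?thesis
    by (intro conjI allI ballI impI coeffs conductor char_eq fact_car POG has_regular_basis_iff
        basis_factorial basis_POG local_basis free)
qed

end
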